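(* Let $G$ be a finitely generated metabelian group which is not virtually abelian, and let $k=\dim_{\mathrm{Krull}}(G)$ be its Krull dimension. Then $G$ has a Schreier growth gap $n^k$.
   Context: Let $G$ be a finitely generated group, $S$ a finite symmetric generating set, and $|\cdot|_S$ the word length. A $G$-set is a non-empty set with a $G$-action (not necessarily transitive); it is faithful if only the identity of $G$ acts trivially. The growth of the action of $G$ on a $G$-set $X$ is $\mathrm{vol}_{G,X}(n)=\max_{x\in X}|\{gx : g\in G,\ |g|_S\le n\}|$. For functions $f,g$ from $\mathbb{N}$ to the non-negative reals, $f(n)\preccurlyeq g(n)$ (equivalently $g(n)\succcurlyeq f(n)$) means that there is a constant $C>0$ such that $f(n)\le C g(Cn)$ for all sufficiently large $n$; $f\simeq g$ means $f\preccurlyeq g$ and $g\preccurlyeq f$. Up to $\simeq$, $\mathrm{vol}_{G,X}$ does not depend on $S$. The group $G$ has a Schreier growth gap $f(n)$ if every faithful $G$-set $X$ satisfies $\mathrm{vol}_{G,X}(n)\succcurlyeq f(n)$. Krull dimension: for a commutative ring $A$ with unit, $\dim(A)$ is the supremum of the lengths $n$ of chains $\mathfrak{p}_0\subsetneq\cdots\subsetneq\mathfrak{p}_n$ of prime ideals of $A$. For a non-zero $A$-module $M$, $\dim(M)=\dim(A/\mathrm{ann}(M))$, where $\mathrm{ann}(M)$ is the annihilator of $M$. If $G$ is a finitely generated metabelian group that is not virtually abelian and $1\to M\to G\to Q\to 1$ is a short exact sequence with $M,Q$ abelian, then $M$ is a $\mathbb{Z}Q$-module via conjugation, and its Krull dimension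 is a positive integer that does not depend on the choice of $(M,Q)$ (known fact); this integer is the Krull dimension $\dim_{\mathrm{Krull}}(G)$ of $G$. *)

theory Defs
  imports Complex_Main "HOL-Library.Extended_Nat" "HOL-Algebra.Algebra"
begin

section \<open>Growth of actions\<close>

definition symmetric_generating_set :: "('a, 'b) monoid_scheme \<Rightarrow> 'a set \<Rightarrow> bool" where
  "symmetric_generating_set G S \<longleftrightarrow>
     S \<subseteq> carrier G \<and> (\<forall>s\<in>S. inv\<^bsub>G\<^esub> s \<in> S) \<and> generate G S = carrier G"

definition finitely_generated :: "('a, 'b) monoid_scheme \<Rightarrow> bool" where
  "finitely_generated G \<longleftrightarrow> (\<exists>S. finite S \<and> S \<subseteq> carrier G \<and> generate G S = carrier G)"

definition word_length :: "('a, 'b) monoid_scheme \<Rightarrow> 'a set \<Rightarrow> 'a \<Rightarrow> nat" where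
  "word_length G S g =
     (LEAST n. \<exists>w. set w \<subseteq> S \<and> length w = n \<and> foldr (\<otimes>\<^bsub>G\<^esub>) w \<one>\<^bsub>G\<^esub> = g)"

text \<open>The maximum exists even for infinite \<open>E\<close>: for finite \<open>S\<close>, every cardinality in the set
  is bounded by that of the ball of radius \<open>n\<close> of the group.\<close>

definition action_growth ::
  "('a, 'b) monoid_scheme \<Rightarrow> 'a set \<Rightarrow> 'x set \<Rightarrow> ('a \<Rightarrow> 'x \<Rightarrow> 'x) \<Rightarrow> nat \<Rightarrow> nat" where
  "action_growth G S E \<phi> n =
     Max ((\<lambda>x. card {\<phi> g x | g. g \<in> carrier G \<and> word_length G S g \<le> n}) ` E)"

text \<open>As \<open>g\<close> is only defined on the natural numbers, the constant is a positive integer.\<close>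

definition growth_le :: "(nat \<Rightarrow> real) \<Rightarrow> (nat \<Rightarrow> real) \<Rightarrow> bool" (infix \<open>\<preceq>\<^sub>g\<close> 50) where
  "f \<preceq>\<^sub>g g \<longleftrightarrow> (\<exists>C::nat. C > 0 \<and> (\<forall>\<^sub>F n in sequentially. f n \<le> real C * g (C * n)))"

text \<open>The type argument is the type of the points of the \<open>G\<close>-sets. HOL cannot quantify over
  types inside a definition; leaving \<open>'x\<close> free in a theorem covers the \<open>G\<close>-sets of every type.\<close>

definition schreier_growth_gap ::
  "'x itself \<Rightarrow> ('a, 'b) monoid_scheme \<Rightarrow> (nat \<Rightarrow> real) \<Rightarrow> bool" where
  "schreier_growth_gap (TYPE('x)) G f \<longleftrightarrow>
     (\<forall>S. finite S \<longrightarrow> symmetric_generating_set G S \<longrightarrow>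
       (\<forall>(E :: 'x set) \<phi>. E \<noteq> {} \<longrightarrow> faithful_action G E \<phi> \<longrightarrow>
          f \<preceq>\<^sub>g (\<lambda>n. real (action_growth G S E \<phi> n))))"


section \<open>Metabelian and virtually abelian groups\<close>

text \<open>Up to isomorphism, \<open>1 \<rightarrow> N \<rightarrow> G \<rightarrow> G Mod N \<rightarrow> 1\<close> are all the short exact sequences with
  abelian ends and middle term \<open>G\<close>.\<close>

definition abelian_extension :: "('a, 'b) monoid_scheme \<Rightarrow> 'a set \<Rightarrow> bool" where
  "abelian_extension G N \<longleftrightarrow>
     N \<lhd> G \<and> comm_group (G\<lparr>carrier := N\<rparr>) \<and> comm_group (G Mod N)"

definition metabelian :: "('a, 'b) monoid_scheme \<Rightarrow> bool" where
  "metabelian G \<longleftrightarrow> (\<exists>N. abelian_extension G N)"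

definition virtually_abelian :: "('a, 'b) monoid_scheme \<Rightarrow> bool" where
  "virtually_abelian G \<longleftrightarrow>
     (\<exists>H. subgroup H G \<and> finite (rcosets\<^bsub>G\<^esub> H) \<and> comm_group (G\<lparr>carrier := H\<rparr>))"


section \<open>Krull dimension of rings and modules\<close>

text \<open>The zero ring has no prime ideals and gets dimension \<open>0\<close>.\<close>

definition krull_dim :: "('a, 'b) ring_scheme \<Rightarrow> enat" where
  "krull_dim R =
     Sup {enat n | n. \<exists>p :: nat \<Rightarrow> 'a set.
       (\<forall>i\<le>n. primeideal (p i) R) \<and> (\<forall>i<n. p i \<subset> p (Suc i))}"

definition annihilator :: "('r, 'c) ring_scheme \<Rightarrow> ('r, 'm, 'd) module_scheme \<Rightarrow> 'r set" where
  "annihilator R M = {a \<in> carrier R. \<forall>x\<in>carrier M. a \<odot>\<^bsub>M\<^esub> x = \<zero>\<^bsub>M\<^esub>}"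

definition module_krull_dim :: "('r, 'c) ring_scheme \<Rightarrow> ('r, 'm, 'd) module_scheme \<Rightarrow> enat" where
  "module_krull_dim R M = krull_dim (R Quot annihilator R M)"


section \<open>The integral group ring\<close>

definition int_group_ring :: "('q, 'b) monoid_scheme \<Rightarrow> ('q \<Rightarrow>\<^sub>0 int) ring" where
  "int_group_ring Q =
     \<lparr>carrier = {c. Poly_Mapping.keys c \<subseteq> carrier Q},
      monoid.mult = (\<lambda>a b. frag_extend (\<lambda>x. frag_extend (\<lambda>y. frag_of (x \<otimes>\<^bsub>Q\<^esub> y)) b) a),
      one = frag_of \<one>\<^bsub>Q\<^esub>,
      ring.zero = 0,
      ring.add = (+)\<rparr>"

lemma int_group_ring_simps:
  "carrier (int_group_ring Q) = {c. Poly_Mapping.keys c \<subseteq> carrier Q}"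
  "a \<otimes>\<^bsub>int_group_ring Q\<^esub> b = frag_extend (\<lambda>x. frag_extend (\<lambda>y. frag_of (x \<otimes>\<^bsub>Q\<^esub> y)) b) a"
  "\<one>\<^bsub>int_group_ring Q\<^esub> = frag_of \<one>\<^bsub>Q\<^esub>"
  "\<zero>\<^bsub>int_group_ring Q\<^esub> = 0"
  "a \<oplus>\<^bsub>int_group_ring Q\<^esub> b = a + b"
  by (simp_all add: int_group_ring_def)

lemma frag_extend_fun_diff:
  "frag_extend (\<lambda>x. f x - g x) c = frag_extend f c - frag_extend g c"
proof -
  have "frag_cmul k (u - v) = frag_cmul k u - frag_cmul k v" for k and u v :: "'a \<Rightarrow>\<^sub>0 int"
    by (intro poly_mapping_eqI) (simp add: lookup_minus algebra_simps)
  then show ?thesis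
    by (simp add: frag_extend_def sum_subtractf)
qed

lemma keys_int_group_ring_mult:
  assumes "comm_group Q" "Poly_Mapping.keys a \<subseteq> carrier Q" "Poly_Mapping.keys b \<subseteq> carrier Q"
  shows "Poly_Mapping.keys (a \<otimes>\<^bsub>int_group_ring Q\<^esub> b) \<subseteq> carrier Q"
proof -
  interpret comm_group Q by fact
  show ?thesis
    unfolding int_group_ring_simps
    using assms(2,3)
    by (intro order_trans[OF keys_frag_extend] UN_least order_trans[OF keys_frag_extend]) auto
qed

lemma int_group_ring_cring:
  assumes "comm_group Q"
  shows "cring (int_group_ring Q)"
proof -
  interpret comm_group Q by fact
  let ?m = "\<lambda>a b. a \<otimes>\<^bsub>int_group_ring Q\<^esub> b"
  have diff_l: "?m (a - b) c = ?m a c - ?m b c" for a b c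
    by (simp add: int_group_ring_simps frag_extend_diff)
  have diff_r: "?m a (b - c) = ?m a b - ?m a c" for a b c
    by (simp add: int_group_ring_simps frag_extend_diff frag_extend_fun_diff)
  have add_l: "?m (a + b) c = ?m a c + ?m b c" for a b c
    by (simp add: int_group_ring_simps frag_extend_add)
  have zero: "?m 0 c = 0" "?m c 0 = 0" for c
    by (simp_all add: int_group_ring_simps frag_extend_eq_0)
  have one: "?m (frag_of \<one>\<^bsub>Q\<^esub>) a = a" if "Poly_Mapping.keys a \<subseteq> carrier Q" for a
    using that
    by (induction a rule: frag_induction)
      (simp_all add: zero diff_r, simp add: int_group_ring_simps)
  have comm: "?m a b = ?m b a"
    if a: "Poly_Mapping.keys a \<subseteq> carrier Q" and b: "Poly_Mapping.keys b \<subseteq> carrier Q" for a b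
    using a
  proof (induction a rule: frag_induction)
    case (one x)
    show ?case
      using b
      by (induction b rule: frag_induction)
        (use one in \<open>simp_all add: zero diff_r diff_l\<close>, simp add: int_group_ring_simps m_comm)
  qed (simp_all add: zero diff_l diff_r)
  have assoc: "?m (?m a b) c = ?m a (?m b c)"
    if a: "Poly_Mapping.keys a \<subseteq> carrier Q" and b: "Poly_Mapping.keys b \<subseteq> carrier Q"
      and c: "Poly_Mapping.keys c \<subseteq> carrier Q" for a b c
    using a
  proof (induction a rule: frag_induction)
    case x: (one x)
    show ?case
      using b
    proof (induction b rule: frag_induction)
      case y: (one y)
      show ?case
        using c
        by (induction c rule: frag_induction)
          (use x y in \<open>simp_all add: zero diff_r diff_l\<close>, simp add: int_group_ring_simps m_assoc)
    qed (simp_all add: zero diff_l diff_r)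
  qed (simp_all add: zero diff_l diff_r)
  show ?thesis
  proof (rule cringI)
    show "abelian_group (int_group_ring Q)"
    proof (rule abelian_groupI)
      fix x assume "x \<in> carrier (int_group_ring Q)"
      then show "\<exists>y\<in>carrier (int_group_ring Q). y \<oplus>\<^bsub>int_group_ring Q\<^esub> x = \<zero>\<^bsub>int_group_ring Q\<^esub>"
        by (intro bexI[of _ "- x"]) (auto simp: int_group_ring_simps)
    next
      fix x y assume "x \<in> carrier (int_group_ring Q)" "y \<in> carrier (int_group_ring Q)"
      then show "x \<oplus>\<^bsub>int_group_ring Q\<^esub> y \<in> carrier (int_group_ring Q)"
        using keys_add[of x y] by (auto simp: int_group_ring_simps)
    qed (auto simp: int_group_ring_simps(1,4,5) algebra_simps)
  next
    show "comm_monoid (int_group_ring Q)"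
    proof (rule comm_monoidI)
      fix a b assume "a \<in> carrier (int_group_ring Q)" "b \<in> carrier (int_group_ring Q)"
      then show "?m a b = ?m b a"
        by (simp add: int_group_ring_simps(1) comm)
    next
      fix a b assume "a \<in> carrier (int_group_ring Q)" "b \<in> carrier (int_group_ring Q)"
      then show "?m a b \<in> carrier (int_group_ring Q)"
        using keys_int_group_ring_mult[OF assms] by (simp add: int_group_ring_simps(1))
    qed (auto simp: int_group_ring_simps(1,3) assoc one)
  qed (auto simp: int_group_ring_simps(5) add_l)
qed


section \<open>The conjugation module and the Krull dimension of a metabelian group\<close>

text \<open>A coset \<open>q\<close> of the abelian group \<open>N\<close> acts on \<open>N\<close> through conjugation by any of its
  elements. The element \<open>\<Sum>\<^sub>q c\<^sub>q q\<close> of the group ring then sends \<open>m\<close> to the product of the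
  \<open>(q \<cdot> m)\<close> to the power \<open>c\<^sub>q\<close>. The fields \<open>mult\<close> and \<open>one\<close> of the module record play no role.\<close>

definition coset_conj :: "('a, 'b) monoid_scheme \<Rightarrow> 'a set \<Rightarrow> 'a \<Rightarrow> 'a" where
  "coset_conj G q m = (let g = (SOME g. g \<in> q) in g \<otimes>\<^bsub>G\<^esub> m \<otimes>\<^bsub>G\<^esub> inv\<^bsub>G\<^esub> g)"

definition conj_module ::
  "('a, 'b) monoid_scheme \<Rightarrow> 'a set \<Rightarrow> ('a set \<Rightarrow>\<^sub>0 int, 'a) module" where
  "conj_module G N =
     \<lparr>carrier = N, monoid.mult = (\<otimes>\<^bsub>G\<^esub>), one = \<one>\<^bsub>G\<^esub>, ring.zero = \<one>\<^bsub>G\<^esub>, ring.add = (\<otimes>\<^bsub>G\<^esub>),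
      smult = (\<lambda>c m. finprod (G\<lparr>carrier := N\<rparr>)
        (\<lambda>q. coset_conj G q m [^]\<^bsub>G\<^esub> Poly_Mapping.lookup c q) (Poly_Mapping.keys c))\<rparr>"

lemma conj_module_simps:
  "carrier (conj_module G N) = N"
  "\<zero>\<^bsub>conj_module G N\<^esub> = \<one>\<^bsub>G\<^esub>"
  "x \<oplus>\<^bsub>conj_module G N\<^esub> y = x \<otimes>\<^bsub>G\<^esub> y"
  "c \<odot>\<^bsub>conj_module G N\<^esub> m = finprod (G\<lparr>carrier := N\<rparr>)
     (\<lambda>q. coset_conj G q m [^]\<^bsub>G\<^esub> Poly_Mapping.lookup c q) (Poly_Mapping.keys c)"
  by (simp_all add: conj_module_def)

text \<open>A relation rather than a function, since independence of \<open>N\<close> is a theorem: a statement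
  about every \<open>d\<close> with \<open>has_krull_dim G d\<close> covers every choice of \<open>N\<close>.\<close>

definition has_krull_dim :: "('a, 'b) monoid_scheme \<Rightarrow> enat \<Rightarrow> bool" where
  "has_krull_dim G d \<longleftrightarrow>
     (\<exists>N. abelian_extension G N \<and>
          d = module_krull_dim (int_group_ring (G Mod N)) (conj_module G N))"

lemma coset_conj_eq:
  assumes "abelian_extension G N" "g \<in> carrier G" "m \<in> N"
  shows "coset_conj G (N #>\<^bsub>G\<^esub> g) m = g \<otimes>\<^bsub>G\<^esub> m \<otimes>\<^bsub>G\<^esub> inv\<^bsub>G\<^esub> g"
proof -
  interpret normal N G using assms(1) by (simp add: abelian_extension_def)
  interpret N: comm_group "G\<lparr>carrier := N\<rparr>" using assms(1) by (simp add: abelian_extension_def)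
  have "g \<in> N #>\<^bsub>G\<^esub> g"
    using rcos_self[OF assms(2) is_subgroup] .
  then have "(SOME h. h \<in> N #>\<^bsub>G\<^esub> g) \<in> N #>\<^bsub>G\<^esub> g"
    by (rule someI)
  then obtain n where n: "n \<in> N" "(SOME h. h \<in> N #>\<^bsub>G\<^esub> g) = n \<otimes>\<^bsub>G\<^esub> g"
    by (auto simp: r_coset_def)
  have c: "g \<otimes>\<^bsub>G\<^esub> m \<otimes>\<^bsub>G\<^esub> inv\<^bsub>G\<^esub> g \<in> N"
    using assms by (simp add: inv_op_closed2)
  have "n \<otimes>\<^bsub>G\<^esub> g \<otimes>\<^bsub>G\<^esub> m \<otimes>\<^bsub>G\<^esub> inv\<^bsub>G\<^esub> (n \<otimes>\<^bsub>G\<^esub> g)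
      = n \<otimes>\<^bsub>G\<^esub> (g \<otimes>\<^bsub>G\<^esub> m \<otimes>\<^bsub>G\<^esub> inv\<^bsub>G\<^esub> g) \<otimes>\<^bsub>G\<^esub> inv\<^bsub>G\<^esub> n"
    using n assms by (simp add: m_assoc inv_mult_group mem_carrier)
  also have "\<dots> = g \<otimes>\<^bsub>G\<^esub> m \<otimes>\<^bsub>G\<^esub> inv\<^bsub>G\<^esub> g \<otimes>\<^bsub>G\<^esub> n \<otimes>\<^bsub>G\<^esub> inv\<^bsub>G\<^esub> n"
    using N.m_comm[of n "g \<otimes>\<^bsub>G\<^esub> m \<otimes>\<^bsub>G\<^esub> inv\<^bsub>G\<^esub> g"] n c by simp
  also have "\<dots> = g \<otimes>\<^bsub>G\<^esub> m \<otimes>\<^bsub>G\<^esub> inv\<^bsub>G\<^esub> g"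
    using n c mem_carrier by (metis inv_solve_right m_closed)
  finally show ?thesis
    by (simp add: coset_conj_def n)
qed

lemma conj_module_module:
  assumes "abelian_extension G N"
  shows "module (int_group_ring (G Mod N)) (conj_module G N)"
proof -
  interpret normal N G using assms by (simp add: abelian_extension_def)
  interpret N: comm_group "G\<lparr>carrier := N\<rparr>" using assms by (simp add: abelian_extension_def)
  have Q: "comm_group (G Mod N)" using assms by (simp add: abelian_extension_def)
  note N_mult = subgroup.m_closed[OF is_subgroup]
    and N_one = subgroup.one_closed[OF is_subgroup]
    and N_inv = subgroup.m_inv_closed[OF is_subgroup]
  interpret Q: comm_group "G Mod N" by (rule Q)
  let ?H = "G\<lparr>carrier := N\<rparr>"
  let ?R = "int_group_ring (G Mod N)"
  let ?c = "coset_conj G"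
  let ?s = "\<lambda>c m. c \<odot>\<^bsub>conj_module G N\<^esub> m"
  let ?K = "\<lambda>c. Poly_Mapping.keys c \<subseteq> carrier (G Mod N)"
  let ?f = "\<lambda>(c :: 'a set \<Rightarrow>\<^sub>0 int) m q. ?c q m [^]\<^bsub>?H\<^esub> Poly_Mapping.lookup c q"
  have c_closed: "?c q m \<in> N" if "q \<in> carrier (G Mod N)" "m \<in> N" for q m
    using that coset_conj_eq[OF assms] inv_op_closed2
    by (auto simp: FactGroup_def RCOSETS_def)
  have c_mult: "?c q (m \<otimes>\<^bsub>G\<^esub> m') = ?c q m \<otimes>\<^bsub>G\<^esub> ?c q m'"
    if q: "q \<in> carrier (G Mod N)" and m: "m \<in> N" "m' \<in> N" for q m m'
  proof -
    obtain g where g: "g \<in> carrier G" "q = N #>\<^bsub>G\<^esub> g"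
      using q by (auto simp: FactGroup_def RCOSETS_def)
    have "g \<otimes>\<^bsub>G\<^esub> m \<otimes>\<^bsub>G\<^esub> inv\<^bsub>G\<^esub> g \<otimes>\<^bsub>G\<^esub> (g \<otimes>\<^bsub>G\<^esub> m' \<otimes>\<^bsub>G\<^esub> inv\<^bsub>G\<^esub> g)
        = g \<otimes>\<^bsub>G\<^esub> m \<otimes>\<^bsub>G\<^esub> (inv\<^bsub>G\<^esub> g \<otimes>\<^bsub>G\<^esub> (g \<otimes>\<^bsub>G\<^esub> (m' \<otimes>\<^bsub>G\<^esub> inv\<^bsub>G\<^esub> g)))"
      using g m mem_carrier by (simp add: m_assoc)
    also have "\<dots> = g \<otimes>\<^bsub>G\<^esub> (m \<otimes>\<^bsub>G\<^esub> m') \<otimes>\<^bsub>G\<^esub> inv\<^bsub>G\<^esub> g"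
      using g m mem_carrier by (simp add: inv_solve_left' m_assoc flip: m_assoc[of "inv\<^bsub>G\<^esub> g" g])
    finally show ?thesis
      using g m coset_conj_eq[OF assms] by simp
  qed
  have c_comp: "?c (p \<otimes>\<^bsub>G Mod N\<^esub> q) m = ?c p (?c q m)"
    if p: "p \<in> carrier (G Mod N)" and q: "q \<in> carrier (G Mod N)" and m: "m \<in> N" for p q m
  proof -
    obtain g h where g: "g \<in> carrier G" "p = N #>\<^bsub>G\<^esub> g" and h: "h \<in> carrier G" "q = N #>\<^bsub>G\<^esub> h"
      using p q by (auto simp: FactGroup_def RCOSETS_def)
    have "p \<otimes>\<^bsub>G Mod N\<^esub> q = N #>\<^bsub>G\<^esub> (g \<otimes>\<^bsub>G\<^esub> h)"
      using g h rcos_sum by (simp add: FactGroup_def)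
    then show ?thesis
      using g h m mem_carrier c_closed[OF q m] coset_conj_eq[OF assms]
      by (simp add: m_assoc inv_mult_group)
  qed
  have c_one: "?c \<one>\<^bsub>G Mod N\<^esub> m = m" if "m \<in> N" for m
    using coset_conj_eq[OF assms, of "\<one>\<^bsub>G\<^esub>" m] that mem_carrier subset coset_mult_one
    by (simp add: FactGroup_def)
  have s: "?s c m = finprod ?H (?f c m) (Poly_Mapping.keys c)" if "?K c" "m \<in> N" for c m
    unfolding conj_module_simps
    by (intro N.finprod_cong') (use that c_closed in
        \<open>auto simp: int_pow_consistent[OF is_subgroup] intro: N.int_pow_closed[simplified]\<close>)
  have f_closed: "?f c m q \<in> N" if "q \<in> carrier (G Mod N)" "m \<in> N" for c m q
    using N.int_pow_closed c_closed that by simp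
  have s_mono: "?s c m = finprod ?H (?f c m) A"
    if "?K c" "m \<in> N" "finite A" "Poly_Mapping.keys c \<subseteq> A" "A \<subseteq> carrier (G Mod N)" for c m A
    unfolding s[OF that(1,2)]
    by (rule N.finprod_mono_neutral_cong_left)
      (use that f_closed in \<open>auto simp: in_keys_iff\<close>)
  have s_closed: "?s c m \<in> N" if "?K c" "m \<in> N" for c m
    unfolding s[OF that] using N.finprod_closed[of "?f c m" "Poly_Mapping.keys c"] f_closed that
    by (simp add: Pi_def subset_iff)
  have s_add: "?s (a + b) m = ?s a m \<otimes>\<^bsub>G\<^esub> ?s b m" if a: "?K a" and b: "?K b" and m: "m \<in> N" for a b m
  proof -
    let ?A = "Poly_Mapping.keys a \<union> Poly_Mapping.keys b"
    have A: "?A \<subseteq> carrier (G Mod N)" using a b by auto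
    have ab: "?K (a + b)" using A keys_add[of a b] by auto
    have "?s (a + b) m = finprod ?H (?f (a + b) m) ?A"
      by (rule s_mono[OF ab m]) (use A keys_add[of a b] in auto)
    also have "\<dots> = finprod ?H (\<lambda>q. ?f a m q \<otimes>\<^bsub>?H\<^esub> ?f b m q) ?A"
      by (rule N.finprod_cong')
        (use A f_closed m c_closed N.int_pow_mult in \<open>auto simp: lookup_add\<close>)
    also have "\<dots> = finprod ?H (?f a m) ?A \<otimes>\<^bsub>?H\<^esub> finprod ?H (?f b m) ?A"
      by (rule N.finprod_multf) (use A f_closed m in auto)
    also have "\<dots> = ?s a m \<otimes>\<^bsub>G\<^esub> ?s b m"
      using s_mono[OF a m _ _ A] s_mono[OF b m _ _ A] by simp
    finally show ?thesis .
  qed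
  have s_zero: "?s 0 m = \<one>\<^bsub>G\<^esub>" for m
    by (simp add: conj_module_simps)
  have s_diff: "?s (a - b) m = ?s a m \<otimes>\<^bsub>G\<^esub> inv\<^bsub>G\<^esub> ?s b m"
    if a: "?K a" and b: "?K b" and m: "m \<in> N" for a b m
  proof -
    have ab: "?K (a - b)" using keys_diff[of a b] a b by auto
    have "?s a m = ?s (a - b) m \<otimes>\<^bsub>G\<^esub> ?s b m"
      using s_add[OF ab b m] by simp
    then show ?thesis
      using s_closed[OF a m] s_closed[OF b m] s_closed[OF ab m] mem_carrier
      by (metis inv_solve_right)
  qed
  have s_of: "?s (frag_of q) m = ?c q m" if "q \<in> carrier (G Mod N)" "m \<in> N" for q m
    using s[of "frag_of q" m] that c_closed N.int_pow_1
    by (simp add: Pi_def)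
  have s_mult: "?s c (m \<otimes>\<^bsub>G\<^esub> m') = ?s c m \<otimes>\<^bsub>G\<^esub> ?s c m'"
    if c: "?K c" and m: "m \<in> N" "m' \<in> N" for c m m'
  proof -
    have "?s c (m \<otimes>\<^bsub>G\<^esub> m') = finprod ?H (\<lambda>q. ?f c m q \<otimes>\<^bsub>?H\<^esub> ?f c m' q) (Poly_Mapping.keys c)"
      unfolding s[OF c N_mult[OF m]]
      by (rule N.finprod_cong')
        (use c m c_closed c_mult f_closed N.int_pow_distrib in \<open>auto simp: subset_iff\<close>)
    also have "\<dots> = ?s c m \<otimes>\<^bsub>G\<^esub> ?s c m'"
      using s[OF c m(1)] s[OF c m(2)] N.finprod_multf[of "?f c m" "Poly_Mapping.keys c" "?f c m'"]
        f_closed c m by (auto simp: Pi_def subset_iff)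
    finally show ?thesis .
  qed
  have s_inv: "?s c (inv\<^bsub>G\<^esub> m) = inv\<^bsub>G\<^esub> ?s c m" if c: "?K c" and m: "m \<in> N" for c m
  proof -
    have "?s c \<one>\<^bsub>G\<^esub> = \<one>\<^bsub>G\<^esub>"
      using s_mult[OF c N_one N_one] s_closed[OF c N_one] mem_carrier
      by (metis l_cancel_one' one_closed r_one)
    then have "?s c (inv\<^bsub>G\<^esub> m) \<otimes>\<^bsub>G\<^esub> ?s c m = \<one>\<^bsub>G\<^esub>"
      using s_mult[OF c N_inv[OF m] m] m mem_carrier by simp
    then show ?thesis
      using s_closed[OF c m] s_closed[OF c N_inv[OF m]] mem_carrier
      by (metis inv_equality)
  qed
  interpret R: cring ?R by (rule int_group_ring_cring[OF Q])
  have K: "?K c \<longleftrightarrow> c \<in> carrier ?R" for c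
    by (simp add: int_group_ring_simps)
  have K_mult: "?K (a \<otimes>\<^bsub>?R\<^esub> b)" if "?K a" "?K b" for a b
    using that R.m_closed by (simp add: K)
  have mult_diff: "(a - b) \<otimes>\<^bsub>?R\<^esub> c = a \<otimes>\<^bsub>?R\<^esub> c - b \<otimes>\<^bsub>?R\<^esub> c"
    "c \<otimes>\<^bsub>?R\<^esub> (a - b) = c \<otimes>\<^bsub>?R\<^esub> a - c \<otimes>\<^bsub>?R\<^esub> b"
    "0 \<otimes>\<^bsub>?R\<^esub> c = 0" "c \<otimes>\<^bsub>?R\<^esub> 0 = 0" for a b c
    by (simp_all add: int_group_ring_simps(2) frag_extend_diff frag_extend_fun_diff frag_extend_eq_0)
  have s_assoc: "?s (a \<otimes>\<^bsub>?R\<^esub> b) m = ?s a (?s b m)"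
    if a: "?K a" and b: "?K b" and m: "m \<in> N" for a b m
  proof -
    have "?K a \<and> ?s (a \<otimes>\<^bsub>?R\<^esub> b) m = ?s a (?s b m)"
      using a
    proof (induction a rule: frag_induction)
      case x: (one x)
      then have Kx: "?K (frag_of x)" by simp
      have "?K b \<and> ?s (frag_of x \<otimes>\<^bsub>?R\<^esub> b) m = ?s (frag_of x) (?s b m)"
        using b
      proof (induction b rule: frag_induction)
        case zero
        have "?s (frag_of x) \<one>\<^bsub>G\<^esub> = \<one>\<^bsub>G\<^esub>"
          using s_mult[OF Kx N_one N_one] s_closed[OF Kx N_one] mem_carrier
          by (metis l_cancel_one' one_closed r_one)
        then show ?case by (simp add: mult_diff s_zero)
      next
        case y: (one y)
        have "x \<otimes>\<^bsub>G Mod N\<^esub> y \<in> carrier (G Mod N)"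
          by (rule Q.m_closed[OF x y])
        then show ?case
          using x y m c_closed c_comp by (simp add: s_of int_group_ring_simps(2))
      next
        case (diff a b)
        then have ab: "?K a" "?K b" by auto
        have "?K (a - b)" using keys_diff[of a b] ab by auto
        moreover have "?s (frag_of x \<otimes>\<^bsub>?R\<^esub> (a - b)) m
            = ?s (frag_of x \<otimes>\<^bsub>?R\<^esub> a) m \<otimes>\<^bsub>G\<^esub> inv\<^bsub>G\<^esub> ?s (frag_of x \<otimes>\<^bsub>?R\<^esub> b) m"
          unfolding mult_diff by (rule s_diff[OF K_mult[OF Kx ab(1)] K_mult[OF Kx ab(2)] m])
        ultimately show ?case
          using diff s_diff[OF ab m] s_mult[OF Kx] s_inv[OF Kx] s_closed[OF ab(1) m]
            s_closed[OF ab(2) m] N_inv by simp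
      qed
      then show ?case using Kx by simp
    next
      case (diff a' b')
      then have ab: "?K a'" "?K b'" by auto
      have "?K (a' - b')" using keys_diff[of a' b'] ab by auto
      moreover have "?s ((a' - b') \<otimes>\<^bsub>?R\<^esub> b) m
          = ?s (a' \<otimes>\<^bsub>?R\<^esub> b) m \<otimes>\<^bsub>G\<^esub> inv\<^bsub>G\<^esub> ?s (b' \<otimes>\<^bsub>?R\<^esub> b) m"
        unfolding mult_diff by (rule s_diff[OF K_mult[OF ab(1) b] K_mult[OF ab(2) b] m])
      ultimately show ?case
        using diff s_diff[OF ab s_closed[OF b m]] by simp
    qed (simp add: mult_diff s_zero)
    then show ?thesis by simp
  qed
  show ?thesis
  proof (rule moduleI)
    show "abelian_group (conj_module G N)"
    proof (rule abelian_groupI)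
      fix x assume "x \<in> carrier (conj_module G N)"
      then show "\<exists>y\<in>carrier (conj_module G N). y \<oplus>\<^bsub>conj_module G N\<^esub> x = \<zero>\<^bsub>conj_module G N\<^esub>"
        using mem_carrier by (auto simp: conj_module_simps(1-3) intro!: bexI[of _ "inv\<^bsub>G\<^esub> x"])
    next
      fix x y assume "x \<in> carrier (conj_module G N)" "y \<in> carrier (conj_module G N)"
      then show "x \<oplus>\<^bsub>conj_module G N\<^esub> y = y \<oplus>\<^bsub>conj_module G N\<^esub> x"
        using N.m_comm by (simp add: conj_module_simps(1-3))
    qed (use mem_carrier in \<open>auto simp: conj_module_simps(1-3) m_assoc\<close>)
  next
    fix x assume "x \<in> carrier (conj_module G N)"
    then show "?s \<one>\<^bsub>?R\<^esub> x = x"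
      using s_of[of "\<one>\<^bsub>G Mod N\<^esub>" x] c_one Q.one_closed
      unfolding conj_module_simps(1) int_group_ring_simps(3) by simp
  qed (use R.is_cring s_closed s_add s_mult s_assoc in
      \<open>auto simp: conj_module_simps(1-3) int_group_ring_simps(1,5)\<close>)
qed

end

theory Submission
  imports Defs
begin

text \<open>Let \<open>R\<close> be the group ring of \<open>Q = G/N\<close> and \<open>p\<^sub>0 \<subset> \<dots> \<subset> p\<^sub>k\<close> a chain of primes above the annihilator
  of \<open>N\<close>. Choosing \<open>z\<^sub>i \<in> p\<^sub>i - p\<^sub>i\<^sub>-\<^sub>1\<close>, the monomials in the \<open>z\<^sub>i\<close> with exponents below \<open>n\<close> are
  independent modulo \<open>p\<^sub>0\<close>, apart from one step at which the residue characteristic may jump from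
  \<open>0\<close> to a prime. Since they are combinations of elements of a ball of radius \<open>O(n)\<close> in \<open>Q\<close>, there are
  \<open>n\<^sup>k\<close> elements \<open>j q\<close> of \<open>R\<close>, with \<open>j \<le> n\<close> and \<open>q\<close> in that ball, pairwise incongruent modulo \<open>p\<^sub>0\<close>.

  The product of their differences is not in \<open>p\<^sub>0\<close>, hence does not kill one of the finitely many
  generators \<open>m\<close> of \<open>N\<close>, and by faithfulness the result moves a point \<open>x\<close>. Let \<open>K\<close> be the image in \<open>Q\<close>
  of the stabilizer of \<open>x\<close>. The elements \<open>q\<close> lie in some number \<open>c\<close> of cosets of \<open>K\<close>, one of which
  contains at least \<open>n\<^sup>k/c\<close> of the \<open>j q\<close>. As the stabilizer of \<open>x\<close> in \<open>N\<close> is invariant under \<open>K\<close>, the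
  elements of that coset yield \<open>n\<^sup>k/c\<close> distinct points \<open>(j q m) x\<close> of the orbit \<open>N x\<close>, and
  representatives of the cosets carry them into \<open>c\<close> disjoint \<open>N\<close>-orbits.\<close>

section \<open>Linear algebra over the integers modulo a prime\<close>

text \<open>Gaussian elimination over the domain of integers modulo \<open>l\<close>, where
  \<open>l\<close> is \<open>0\<close> or a prime up to sign: more vectors than coordinates are
  dependent. Cross-multiplication replaces division.\<close>

lemma int_elimination:
  fixes b :: "'i \<Rightarrow> 't \<Rightarrow> int" and l :: int
  assumes l: "\<And>x y. l dvd x * y \<Longrightarrow> l dvd x \<or> l dvd y" "\<not> l dvd 1"
    and "finite T" "finite A" "card T < card A"
  shows "\<exists>c. (\<exists>a\<in>A. \<not> l dvd c a) \<and> (\<forall>t\<in>T. l dvd (\<Sum>a\<in>A. c a * b a t))"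
  using assms(3-5)
proof (induction T arbitrary: A b rule: finite_induct)
  case empty
  then show ?case
    using l(2) by (intro exI[of _ "\<lambda>_. 1"]) (auto simp: card_gt_0_iff)
next
  case (insert t T)
  show ?case
  proof (cases "\<forall>a\<in>A. l dvd b a t")
    case True
    from insert.IH[OF insert.prems(1)] insert.prems(2) insert.hyps
    obtain c where "\<exists>a\<in>A. \<not> l dvd c a" "\<forall>t\<in>T. l dvd (\<Sum>a\<in>A. c a * b a t)"
      by force
    with True show ?thesis
      by (intro exI[of _ c]) (auto intro!: dvd_sum)
  next
    case False
    then obtain a0 where a0: "a0 \<in> A" "\<not> l dvd b a0 t" by blast
    define \<beta> where "\<beta> = b a0 t"
    define A' where "A' = A - {a0}"
    have A': "finite A'" "card T < card A'" "A = insert a0 A'" "a0 \<notin> A'"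
      using insert a0 by (auto simp: A'_def)
    obtain c where c: "\<exists>a\<in>A'. \<not> l dvd c a"
      "\<forall>s\<in>T. l dvd (\<Sum>a\<in>A'. c a * (\<beta> * b a s - b a t * b a0 s))"
      using insert.IH[OF A'(1,2), of "\<lambda>a s. \<beta> * b a s - b a t * b a0 s"] by blast
    \<comment> \<open>The coefficient of the pivot \<open>a0\<close> is chosen to cancel coordinate
      \<open>t\<close>; the others are scaled by the pivot entry \<open>\<beta>\<close>, which is
      not divisible by \<open>l\<close>.\<close>
    define c' where "c' a = (if a = a0 then - (\<Sum>a\<in>A'. c a * b a t) else \<beta> * c a)" for a
    have sum: "(\<Sum>a\<in>A. c' a * b a s) = (\<Sum>a\<in>A'. c a * (\<beta> * b a s - b a t * b a0 s))" for s
    proof -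
      have "(\<Sum>a\<in>A'. c' a * b a s) = (\<Sum>a\<in>A'. \<beta> * c a * b a s)"
        by (rule sum.cong) (use A' in \<open>auto simp: c'_def\<close>)
      then have "(\<Sum>a\<in>A. c' a * b a s)
          = (\<Sum>a\<in>A'. \<beta> * c a * b a s) - (\<Sum>a\<in>A'. c a * b a t) * b a0 s"
        using A' by (simp add: c'_def)
      also have "\<dots> = (\<Sum>a\<in>A'. c a * (\<beta> * b a s - b a t * b a0 s))"
        by (simp add: sum_distrib_right sum_distrib_left right_diff_distrib sum_subtractf mult_ac)
      finally show ?thesis .
    qed
    have "\<exists>a\<in>A. \<not> l dvd c' a"
    proof -
      obtain a where "a \<in> A'" "\<not> l dvd c a" using c(1) by blast
      then have "\<not> l dvd c' a" using A' a0 l(1)[of \<beta> "c a"] by (auto simp: c'_def \<beta>_def)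
      with \<open>a \<in> A'\<close> show ?thesis using A' by blast
    qed
    moreover have "l dvd (\<Sum>a\<in>A. c' a * b a s)" if "s \<in> insert t T" for s
      using that c(2) unfolding sum by (auto simp: \<beta>_def mult.commute)
    ultimately show ?thesis by blast
  qed
qed

text \<open>Division with remainder by the least positive element. It is applied to the integers
  lying in a prime ideal and to the exponents of a generator that occur in a subgroup.\<close>

lemma int_additive_subgroup_principal:
  fixes Z :: "int set"
  assumes "0 \<in> Z" and diff: "\<And>x y. x \<in> Z \<Longrightarrow> y \<in> Z \<Longrightarrow> x - y \<in> Z"
    and mult: "\<And>x y. x \<in> Z \<Longrightarrow> y * x \<in> Z"
  shows "\<exists>l. Z = {c. l dvd c}"
proof (cases "Z = {0}")
  case True
  then show ?thesis by (intro exI[of _ 0]) auto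
next
  case False
  then obtain z where z: "z \<in> Z" "z \<noteq> 0" using assms(1) by blast
  define P where "P n \<longleftrightarrow> n > 0 \<and> int n \<in> Z" for n :: nat
  have "P (nat \<bar>z\<bar>)"
    using z mult[of z "sgn z"] by (simp add: P_def abs_sgn mult.commute flip: abs_sgn)
  define n where "n = (LEAST n. P n)"
  have n: "P n" unfolding n_def by (rule LeastI) fact
  have "int n dvd c" if "c \<in> Z" for c
  proof (rule ccontr)
    assume nd: "\<not> int n dvd c"
    have "c - (c div int n) * int n \<in> Z"
      using diff[OF that mult[of "int n"]] n by (simp add: P_def)
    then have "c mod int n \<in> Z" by (simp add: minus_div_mult_eq_mod)
    moreover have "c mod int n > 0" using nd n
      by (metis P_def mod_eq_0_iff_dvd of_nat_0_less_iff order_le_less pos_mod_sign)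
    ultimately have "P (nat (c mod int n))" by (simp add: P_def)
    then have "n \<le> nat (c mod int n)" unfolding n_def by (rule Least_le)
    then show False using n pos_mod_bound[of "int n" c] unfolding P_def by linarith
  qed
  then show ?thesis
    using n mult by (intro exI[of _ "int n"]) (auto simp: P_def elim!: dvdE, metis mult.commute)
qed

lemma ex_transversal:
  \<comment> \<open>A maximal pairwise unrelated subset, so that \<open>P\<close> need not be transitive.\<close>
  assumes "finite W" "\<And>x. x \<in> W \<Longrightarrow> P x x" "\<And>x y. P x y \<Longrightarrow> P y x"
  shows "\<exists>T\<subseteq>W. (\<forall>s\<in>T. \<forall>t\<in>T. P s t \<longrightarrow> s = t) \<and> (\<forall>w\<in>W. \<exists>t\<in>T. P w t)"
  using assms(1,2)
proof (induction W rule: finite_induct)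
  case (insert x W)
  then obtain T where T: "T \<subseteq> W" "\<forall>s\<in>T. \<forall>t\<in>T. P s t \<longrightarrow> s = t" "\<forall>w\<in>W. \<exists>t\<in>T. P w t"
    by auto
  show ?case
  proof (cases "\<exists>t\<in>T. P x t")
    case True
    with T show ?thesis by (intro exI[of _ T]) auto
  next
    case False
    moreover have "\<forall>t\<in>T. \<not> P t x" using False assms(3) by blast
    moreover have "P x x" using insert.prems by simp
    ultimately have "\<forall>s\<in>insert x T. \<forall>t\<in>insert x T. P s t \<longrightarrow> s = t"
      "\<forall>w\<in>insert x W. \<exists>t\<in>insert x T. P w t"
      using False T(2,3) by blast+
    with insert_mono[OF T(1)] show ?thesis by (intro exI[of _ "insert x T"] conjI)
  qed
qed simp

section \<open>Prime ideals of the integral group ring\<close>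

locale abelian_group_ring = comm_group Q for Q :: "('q, 'b) monoid_scheme" (structure)
begin

abbreviation "R \<equiv> int_group_ring Q"

sublocale R: cring R
  by (rule int_group_ring_cring) (rule comm_group_axioms)

lemma carrier_R: "a \<in> carrier R \<longleftrightarrow> Poly_Mapping.keys a \<subseteq> carrier Q"
  by (simp add: int_group_ring_simps)

lemma R_zero: "\<zero>\<^bsub>R\<^esub> = 0" and R_add: "a \<oplus>\<^bsub>R\<^esub> b = a + b"
  by (simp_all add: int_group_ring_simps)

lemma R_add_closed: "a \<in> carrier R \<Longrightarrow> b \<in> carrier R \<Longrightarrow> a + b \<in> carrier R"
  using R.add.m_closed by (simp add: R_add)

lemma R_uminus_closed: "a \<in> carrier R \<Longrightarrow> - a \<in> carrier R"
  by (simp add: carrier_R)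

lemma R_diff_closed: "a \<in> carrier R \<Longrightarrow> b \<in> carrier R \<Longrightarrow> a - b \<in> carrier R"
  using R_add_closed[of a "- b"] R_uminus_closed by simp

lemma R_cmul_closed: "a \<in> carrier R \<Longrightarrow> frag_cmul c a \<in> carrier R"
  using keys_cmul[of c a] by (auto simp: carrier_R)

lemma R_sum_closed: "(\<And>i. i \<in> I \<Longrightarrow> f i \<in> carrier R) \<Longrightarrow> sum f I \<in> carrier R"
  using R.zero_closed
  by (induction I rule: infinite_finite_induct) (auto intro!: R_add_closed simp: R_zero)

lemma frag_of_closed: "q \<in> carrier Q \<Longrightarrow> frag_of q \<in> carrier R"
  by (simp add: carrier_R)

lemma R_uminus: "a \<in> carrier R \<Longrightarrow> \<ominus>\<^bsub>R\<^esub> a = - a"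
  by (rule R.minus_equality) (auto simp: R_add R_zero R_uminus_closed)

lemma mult_cmul_left: "frag_cmul c a \<otimes>\<^bsub>R\<^esub> b = frag_cmul c (a \<otimes>\<^bsub>R\<^esub> b)"
  by (simp add: int_group_ring_simps(2) frag_extend_cmul)

lemma mult_cmul_right: "a \<otimes>\<^bsub>R\<^esub> frag_cmul c b = frag_cmul c (a \<otimes>\<^bsub>R\<^esub> b)"
  by (simp add: int_group_ring_simps(2) frag_extend_cmul)
    (simp add: frag_extend_def frag_cmul_sum mult.left_commute)

lemma mult_sum_right:
  assumes "a \<in> carrier R" "\<And>i. i \<in> I \<Longrightarrow> f i \<in> carrier R"
  shows "a \<otimes>\<^bsub>R\<^esub> sum f I = (\<Sum>i\<in>I. a \<otimes>\<^bsub>R\<^esub> f i)"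
  using assms(2)
proof (induction I rule: infinite_finite_induct)
  case (insert x F)
  then show ?case
    using R.r_distr[of "f x" "sum f F" a] assms(1) R_sum_closed[of F f] by (simp add: R_add)
qed (use R.r_null[OF assms(1)] in \<open>auto simp: R_zero\<close>)

lemma mult_diff_left:
  "(a - b) \<otimes>\<^bsub>R\<^esub> c = a \<otimes>\<^bsub>R\<^esub> c - b \<otimes>\<^bsub>R\<^esub> c"
  by (simp add: int_group_ring_simps frag_extend_diff)

lemma frag_of_mult: "frag_of x \<otimes>\<^bsub>R\<^esub> frag_of y = frag_of (x \<otimes> y)"
  by (simp add: int_group_ring_simps)

lemma frag_of_one: "frag_of \<one> = \<one>\<^bsub>R\<^esub>"
  by (simp add: int_group_ring_simps)

context
  fixes p assumes p: "ideal p R"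
begin

lemma ideal_zero: "0 \<in> p"
  using additive_subgroup.zero_closed[OF ideal.axioms(1)[OF p]] by (simp add: R_zero)

lemma ideal_closed: "a \<in> p \<Longrightarrow> a \<in> carrier R"
  using ideal.Icarr[OF p] .

lemma ideal_add: "a \<in> p \<Longrightarrow> b \<in> p \<Longrightarrow> a + b \<in> p"
  using additive_subgroup.a_closed[OF ideal.axioms(1)[OF p]] by (simp add: R_add)

lemma ideal_uminus: "a \<in> p \<Longrightarrow> - a \<in> p"
  using additive_subgroup.a_inv_closed[OF ideal.axioms(1)[OF p]] R_uminus ideal_closed by simp

lemma ideal_diff: "a \<in> p \<Longrightarrow> b \<in> p \<Longrightarrow> a - b \<in> p"
  using ideal_add[of a "- b"] ideal_uminus by simp

lemma ideal_sum: "(\<And>i. i \<in> I \<Longrightarrow> f i \<in> p) \<Longrightarrow> sum f I \<in> p"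
  by (induction I rule: infinite_finite_induct) (auto intro: ideal_add ideal_zero)

lemma ideal_cmul: "a \<in> p \<Longrightarrow> frag_cmul c a \<in> p"
  using ideal.I_l_closed[OF p, of a "frag_cmul c \<one>\<^bsub>R\<^esub>"] ideal_closed[of a]
  by (simp add: mult_cmul_left R_cmul_closed)

lemma ideal_cmul_one: "frag_cmul c \<one>\<^bsub>R\<^esub> \<in> p \<Longrightarrow> a \<in> carrier R \<Longrightarrow> frag_cmul c a \<in> p"
  using ideal.I_r_closed[OF p, of "frag_cmul c \<one>\<^bsub>R\<^esub>" a] by (simp add: mult_cmul_left)

end

text \<open>\<open>l\<close> generates the ideal of integers lying in \<open>p\<close>: it is \<open>0\<close> or a prime, up to sign.\<close>

definition residue_char :: "('q \<Rightarrow>\<^sub>0 int) set \<Rightarrow> int \<Rightarrow> bool" where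
  "residue_char p l \<longleftrightarrow> (\<forall>c. frag_cmul c \<one>\<^bsub>R\<^esub> \<in> p \<longleftrightarrow> l dvd c)"

context
  fixes p assumes p: "primeideal p R"
begin

lemma prime_ideal: "ideal p R"
  using p by (rule primeideal.axioms)

lemma prime_mult: "a \<in> carrier R \<Longrightarrow> b \<in> carrier R \<Longrightarrow> a \<otimes>\<^bsub>R\<^esub> b \<in> p \<Longrightarrow> a \<in> p \<or> b \<in> p"
  using primeideal.I_prime[OF p] .

lemma prime_one: "\<one>\<^bsub>R\<^esub> \<notin> p"
  using primeideal.I_notcarr[OF p] ideal.one_imp_carrier[OF prime_ideal] by blast

lemma prime_cmul: "a \<in> carrier R \<Longrightarrow> frag_cmul c a \<in> p \<Longrightarrow> frag_cmul c \<one>\<^bsub>R\<^esub> \<in> p \<or> a \<in> p"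
  using prime_mult[of "frag_cmul c \<one>\<^bsub>R\<^esub>" a] by (simp add: mult_cmul_left R_cmul_closed)

text \<open>Group elements are units of the group ring.\<close>

lemma frag_of_notin_prime:
  assumes "q \<in> carrier Q"
  shows "frag_of q \<notin> p"
proof
  assume "frag_of q \<in> p"
  then have "frag_of (inv q) \<otimes>\<^bsub>R\<^esub> frag_of q \<in> p"
    using ideal.I_l_closed[OF prime_ideal] frag_of_closed assms by simp
  then show False using prime_one assms by (simp add: frag_of_mult frag_of_one)
qed

lemma ex_residue_char: "\<exists>l. residue_char p l"
proof -
  have "\<exists>l. {c. frag_cmul c \<one>\<^bsub>R\<^esub> \<in> p} = {c. l dvd c}"
  proof (rule int_additive_subgroup_principal)
    fix x y assume "x \<in> {c. frag_cmul c \<one>\<^bsub>R\<^esub> \<in> p}"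
    then have "frag_cmul y (frag_cmul x \<one>\<^bsub>R\<^esub>) \<in> p" using ideal_cmul[OF prime_ideal] by blast
    then show "y * x \<in> {c. frag_cmul c \<one>\<^bsub>R\<^esub> \<in> p}" by simp
  qed (use ideal_zero[OF prime_ideal] ideal_diff[OF prime_ideal] in
      \<open>auto simp: frag_cmul_diff_distrib\<close>)
  then show ?thesis unfolding residue_char_def by blast
qed

context
  fixes l assumes l: "residue_char p l"
begin

lemma residue_char_prime: "l dvd x * y \<Longrightarrow> l dvd x \<or> l dvd y"
  using prime_cmul[of "frag_cmul y \<one>\<^bsub>R\<^esub>" x] l
  by (simp add: residue_char_def R_cmul_closed)

lemma residue_char_not_unit: "\<not> l dvd 1"
  using prime_one l unfolding residue_char_def by (metis frag_cmul_one)

lemma residue_char_cmul: "a \<in> carrier R \<Longrightarrow> frag_cmul c a \<in> p \<longleftrightarrow> l dvd c \<or> a \<in> p"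
  using prime_cmul[of a c] ideal_cmul[OF prime_ideal, of a c]
    ideal_cmul_one[OF prime_ideal, of c a] l
  by (auto simp: residue_char_def)

end

end

text \<open>Linear independence modulo \<open>p\<close> over the image of the integers in the
  residue ring. A coefficient counts as zero when its multiple of the unit lies in \<open>p\<close>,
  which covers characteristic zero and prime characteristic at once.\<close>

definition indep :: "('q \<Rightarrow>\<^sub>0 int) set \<Rightarrow> 'i set \<Rightarrow> ('i \<Rightarrow> 'q \<Rightarrow>\<^sub>0 int) \<Rightarrow> bool" where
  "indep p A y \<longleftrightarrow>
     (\<forall>c. (\<Sum>a\<in>A. frag_cmul (c a) (y a)) \<in> p \<longrightarrow> (\<forall>a\<in>A. frag_cmul (c a) \<one>\<^bsub>R\<^esub> \<in> p))"

text \<open>Modulo \<open>p'\<close> only the constant term of a polynomial in \<open>z\<close>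
  survives, so its coefficients vanish modulo \<open>l\<close>. What remains is divisible by
  \<open>z\<close>, which cancels modulo the prime \<open>p\<close>, and induction on the degree
  applies.\<close>

lemma indep_powers:
  assumes p: "primeideal p R" and p': "primeideal p' R" and sub: "p \<subseteq> p'"
    and l: "residue_char p l" "residue_char p' l"
    and z: "z \<in> p'" "z \<notin> p"
    and ind: "indep p' A y" and y: "\<And>a. a \<in> A \<Longrightarrow> y a \<in> carrier R"
    and 0: "(\<Sum>i<n. z [^]\<^bsub>R\<^esub> i \<otimes>\<^bsub>R\<^esub> (\<Sum>a\<in>A. frag_cmul (c i a) (y a))) \<in> p"
  shows "\<forall>i<(n::nat). \<forall>a\<in>A. l dvd c i a"
  using 0
proof (induction n arbitrary: c)
  case (Suc n)
  define f where "f i = (\<Sum>a\<in>A. frag_cmul (c i a) (y a))" for i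
  have f: "f i \<in> carrier R" for i
    unfolding f_def using y by (intro R_sum_closed R_cmul_closed)
  note I = prime_ideal[OF p] and I' = prime_ideal[OF p']
  have zc: "z \<in> carrier R" using ideal_closed[OF I' z(1)] .
  define g where "g = (\<Sum>i<n. z [^]\<^bsub>R\<^esub> i \<otimes>\<^bsub>R\<^esub> f (Suc i))"
  have g: "g \<in> carrier R" unfolding g_def using zc f by (intro R_sum_closed) auto
  have "(\<Sum>i<Suc n. z [^]\<^bsub>R\<^esub> i \<otimes>\<^bsub>R\<^esub> f i) = f 0 + (\<Sum>i<n. z [^]\<^bsub>R\<^esub> Suc i \<otimes>\<^bsub>R\<^esub> f (Suc i))"
    by (subst sum.lessThan_Suc_shift) (use f in simp)
  also have "(\<Sum>i<n. z [^]\<^bsub>R\<^esub> Suc i \<otimes>\<^bsub>R\<^esub> f (Suc i)) = z \<otimes>\<^bsub>R\<^esub> g"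
    unfolding g_def using zc f
    by (subst mult_sum_right) (auto intro!: sum.cong simp: R.m_ac)
  finally have *: "f 0 + z \<otimes>\<^bsub>R\<^esub> g \<in> p" using Suc.prems by (simp add: f_def)
  have "z \<otimes>\<^bsub>R\<^esub> g \<in> p'" using ideal.I_r_closed[OF I' z(1) g] .
  then have "f 0 \<in> p'" using ideal_diff[OF I', of "f 0 + z \<otimes>\<^bsub>R\<^esub> g" "z \<otimes>\<^bsub>R\<^esub> g"] * sub by auto
  then have c0: "\<forall>a\<in>A. l dvd c 0 a"
    using ind l(2) unfolding indep_def f_def residue_char_def by blast
  \<comment> \<open>The common characteristic \<open>l\<close> carries the vanishing of the constant
    term from \<open>p'\<close> back to \<open>p\<close>.\<close>
  then have "f 0 \<in> p"
    unfolding f_def using y residue_char_cmul[OF p l(1)] by (intro ideal_sum[OF I]) auto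
  then have "z \<otimes>\<^bsub>R\<^esub> g \<in> p" using ideal_diff[OF I, of "f 0 + z \<otimes>\<^bsub>R\<^esub> g" "f 0"] * by simp
  then have "g \<in> p" using prime_mult[OF p zc g] z(2) by blast
  then have "\<forall>i<n. \<forall>a\<in>A. l dvd c (Suc i) a"
    using Suc.IH[of "\<lambda>i. c (Suc i)"] by (simp add: g_def f_def)
  have "l dvd c i a" if "i < Suc n" "a \<in> A" for i a
    using that c0 \<open>\<forall>i<n. \<forall>a\<in>A. l dvd c (Suc i) a\<close> by (cases i) simp_all
  then show ?case by blast
next
  case 0
  show ?case by simp
qed

text \<open>If the characteristic jumps between \<open>p\<close> and \<open>p'\<close>, \<open>l\<close> would be the only
  new variable, and it is a scalar; but dividing a relation by \<open>l\<close> again and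
  again shows that the old family stays independent. The lost factor is regained from the integer
  multiples of the group elements.\<close>

lemma indep_char_zero:
  assumes p: "primeideal p R" and p': "primeideal p' R" and sub: "p \<subseteq> p'"
    and l: "residue_char p 0" "residue_char p' l" "l \<noteq> 0"
    and ind: "indep p' A y" and y: "\<And>a. a \<in> A \<Longrightarrow> y a \<in> carrier R" and fin: "finite A"
  shows "indep p A y"
proof -
  have "\<forall>a\<in>A. c a = 0" if "(\<Sum>a\<in>A. frag_cmul (c a) (y a)) \<in> p" for c :: "_ \<Rightarrow> int"
    using that
  proof (induction "\<Sum>a\<in>A. nat \<bar>c a\<bar>" arbitrary: c rule: less_induct)
    case less
    have "\<forall>a\<in>A. l dvd c a"
      using less.prems sub ind l(2) unfolding indep_def residue_char_def by blast
    define c' where "c' a = c a div l" for a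
    have c': "c a = l * c' a" if "a \<in> A" for a
      using \<open>\<forall>a\<in>A. l dvd c a\<close> that by (simp add: c'_def)
    have "(\<Sum>a\<in>A. frag_cmul (c a) (y a)) = frag_cmul l (\<Sum>a\<in>A. frag_cmul (c' a) (y a))"
      using c' by (simp add: frag_cmul_sum)
    moreover have "(\<Sum>a\<in>A. frag_cmul (c' a) (y a)) \<in> carrier R"
      using y by (intro R_sum_closed R_cmul_closed)
    \<comment> \<open>In characteristic zero no non-zero multiple of the unit lies in
      \<open>p\<close>, so the factor \<open>l\<close> cancels and the quotients \<open>c'\<close>
      satisfy a relation as well.\<close>
    ultimately have c'p: "(\<Sum>a\<in>A. frag_cmul (c' a) (y a)) \<in> p"
      using less.prems residue_char_cmul[OF p l(1)] l(3) by simp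
    show ?case
    proof (rule ccontr)
      assume "\<not> ?thesis"
      then obtain a where a: "a \<in> A" "c a \<noteq> 0" by blast
      \<comment> \<open>Since \<open>p'\<close> is proper, \<open>l\<close> is no unit. Hence
        division by \<open>l\<close> shrinks every non-zero coefficient, which drives the induction
        on the sum of the absolute values.\<close>
      have l1: "\<bar>l\<bar> > 1" using residue_char_not_unit[OF p' l(2)] l(3)
        by (cases "l = 1 \<or> l = - 1") auto
      have lt: "nat \<bar>c' b\<bar> < nat \<bar>c b\<bar>" if "b \<in> A" "c b \<noteq> 0" for b
        using c'[OF that(1)] that l1 by (simp add: abs_mult)
      have "(\<Sum>a\<in>A. nat \<bar>c' a\<bar>) < (\<Sum>a\<in>A. nat \<bar>c a\<bar>)"
      proof (rule sum_strict_mono_ex1[OF fin])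
        show "\<forall>x\<in>A. nat \<bar>c' x\<bar> \<le> nat \<bar>c x\<bar>"
        proof
          fix b assume "b \<in> A"
          then show "nat \<bar>c' b\<bar> \<le> nat \<bar>c b\<bar>"
            using lt[of b] c'[of b] l(3) by (cases "c b = 0") auto
        qed
      qed (use a lt in blast)
      then have "\<forall>a\<in>A. c' a = 0" using less.hyps c'p by blast
      then show False using a c' by simp
    qed
  qed
  then show ?thesis
    unfolding indep_def
  proof (intro allI impI ballI)
    fix c a assume "(\<Sum>a\<in>A. frag_cmul (c a) (y a)) \<in> p" "a \<in> A"
    with \<open>\<And>c. (\<Sum>a\<in>A. frag_cmul (c a) (y a)) \<in> p \<Longrightarrow> \<forall>a\<in>A. c a = 0\<close>[of c]
    have "c a = 0" by blast
    then show "frag_cmul (c a) \<one>\<^bsub>R\<^esub> \<in> p" using ideal_zero[OF prime_ideal[OF p]] by simp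
  qed
qed

end

lemma frag_cmul_diff_distrib2: "frag_cmul k (a - b) = frag_cmul k a - frag_cmul k b"
  by (intro poly_mapping_eqI) (simp add: lookup_minus algebra_simps)

lemma frag_cmul_sum_left: "frag_cmul (sum f I) a = (\<Sum>i\<in>I. frag_cmul (f i) a)"
  by (induction I rule: infinite_finite_induct) (auto simp: frag_cmul_distrib)

section \<open>Incongruent monomials along a chain of primes\<close>

text \<open>\<open>B n\<close> stands for the image in the quotient of the ball of radius
  \<open>n\<close> of the group. It measures the supports of elements of the group ring, with radii
  adding up under products.\<close>

locale filtered_group_ring = abelian_group_ring +
  fixes B :: "nat \<Rightarrow> 'a set"
  assumes B_Union: "(\<Union>n. B n) = carrier Q"
    and B_mono: "m \<le> n \<Longrightarrow> B m \<subseteq> B n"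
    and B_one: "\<one> \<in> B 0"
    and B_mult: "x \<in> B m \<Longrightarrow> y \<in> B n \<Longrightarrow> x \<otimes> y \<in> B (m + n)"
    and B_finite: "finite (B n)"
begin

lemma B_subset: "B n \<subseteq> carrier Q"
  using B_Union by blast

lemma keys_B_closed: "Poly_Mapping.keys a \<subseteq> B n \<Longrightarrow> a \<in> carrier R"
  using B_subset by (auto simp: carrier_R)

lemma keys_B_mult:
  assumes "Poly_Mapping.keys a \<subseteq> B m" "Poly_Mapping.keys b \<subseteq> B n"
  shows "Poly_Mapping.keys (a \<otimes>\<^bsub>R\<^esub> b) \<subseteq> B (m + n)"
  unfolding int_group_ring_simps
  using assms
  by (intro order_trans[OF keys_frag_extend] UN_least order_trans[OF keys_frag_extend])
    (auto intro!: B_mult)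

lemma keys_B_one: "Poly_Mapping.keys \<one>\<^bsub>R\<^esub> \<subseteq> B 0"
  using B_one by (simp add: int_group_ring_simps)

lemma keys_B_power:
  "Poly_Mapping.keys a \<subseteq> B m \<Longrightarrow> Poly_Mapping.keys (a [^]\<^bsub>R\<^esub> (i::nat)) \<subseteq> B (m * i)"
proof (induction i)
  case (Suc i)
  then show ?case using keys_B_mult[of "a [^]\<^bsub>R\<^esub> i" "m * i" a m] by (simp add: add.commute)
qed (use keys_B_one in simp)

lemma ex_keys_B: "a \<in> carrier R \<Longrightarrow> \<exists>n. Poly_Mapping.keys a \<subseteq> B n"
proof -
  assume "a \<in> carrier R"
  then have "\<forall>q\<in>Poly_Mapping.keys a. \<exists>n. q \<in> B n" using B_Union by (auto simp: carrier_R)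
  then obtain f where f: "\<And>q. q \<in> Poly_Mapping.keys a \<Longrightarrow> q \<in> B (f q)" by metis
  have "q \<in> B (Max (f ` Poly_Mapping.keys a))" if "q \<in> Poly_Mapping.keys a" for q
    using f[OF that] B_mono[of "f q" "Max (f ` Poly_Mapping.keys a)"] that by auto
  then show ?thesis by blast
qed

text \<open>The integers in \<open>p\<close> lie in \<open>p'\<close>, so \<open>l'\<close> divides
  the prime \<open>l\<close>; being no unit, it is associated to \<open>l\<close>. Thus along a
  chain the characteristic can change only once, from \<open>0\<close> to a prime.\<close>

lemma residue_char_mono:
  assumes "primeideal p R" "primeideal p' R" "p \<subseteq> p'"
    and l: "residue_char p l" "residue_char p' l'" and "l \<noteq> 0"
  shows "residue_char p' l"
proof -
  have "l' dvd l" using assms(3) l unfolding residue_char_def by (meson dvd_refl subsetD)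
  then obtain e where e: "l = l' * e" by blast
  have "\<not> l dvd e"
  proof
    assume "l dvd e"
    then obtain f where "e = l * f" by blast
    then have "l' * f = 1" using e \<open>l \<noteq> 0\<close> by (simp add: mult.left_commute)
    then show False using residue_char_not_unit[OF assms(2) l(2)] by (metis dvd_triv_left)
  qed
  then have "l dvd l'" using residue_char_prime[OF assms(1) l(1), of l' e] e by simp
  then have "l dvd c \<longleftrightarrow> l' dvd c" for c using \<open>l' dvd l\<close> by (meson dvd_trans)
  then show ?thesis using l(2) by (simp add: residue_char_def)
qed

text \<open>Induction from the top of the chain downwards: a step adjoins powers of some
  \<open>z\<close> in the next prime but not in the current one, and the list indexing a monomial
  records the exponents. The factor \<open>n\<close> allowed when \<open>l = 0\<close> absorbs the
  single possible jump of the characteristic.\<close>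

lemma prime_chain_indep:
  fixes p :: "nat \<Rightarrow> ('a \<Rightarrow>\<^sub>0 int) set"
  assumes "\<And>i. i \<le> k \<Longrightarrow> primeideal (p i) R" "\<And>i. i < k \<Longrightarrow> p i \<subset> p (Suc i)"
    and "residue_char (p 0) l"
  shows "\<exists>D. \<forall>n>0. \<exists>(A :: nat list set) y. finite A \<and>
           n ^ k \<le> card A * (if l = 0 then n else 1) \<and>
           (\<forall>a\<in>A. Poly_Mapping.keys (y a) \<subseteq> B (D * n)) \<and> indep (p 0) A y"
  using assms
proof (induction k arbitrary: p l)
  case 0
  have "indep (p 0) {[]} (\<lambda>_ :: nat list. \<one>\<^bsub>R\<^esub>)"
    by (simp add: indep_def)
  then show ?case
    using keys_B_one by (intro exI[of _ 0] allI impI exI[of _ "{[] :: nat list}"] exI[of _ "\<lambda>_. \<one>\<^bsub>R\<^esub>"]) auto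
next
  case (Suc k)
  have p: "primeideal (p 0) R" "primeideal (p 1) R" and sub: "p 0 \<subset> p 1"
    using Suc.prems by auto
  obtain z where z: "z \<in> p 1" "z \<notin> p 0" using sub by blast
  have zc: "z \<in> carrier R" using ideal_closed[OF prime_ideal[OF p(2)] z(1)] .
  obtain l' where l': "residue_char (p 1) l'" using ex_residue_char[OF p(2)] by blast
  have IH: "\<exists>D. \<forall>n>0. \<exists>(A :: nat list set) y. finite A \<and>
           n ^ k \<le> card A * (if l' = 0 then n else 1) \<and>
           (\<forall>a\<in>A. Poly_Mapping.keys (y a) \<subseteq> B (D * n)) \<and> indep (p 1) A y"
    if "residue_char (p 1) l'" for l'
    using Suc.IH[of "\<lambda>i. p (Suc i)" l'] Suc.prems(1,2) that by simp
  show ?case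
  proof (cases "l = 0 \<and> l' \<noteq> 0")
    case True
    \<comment> \<open>The characteristic jumps: the family for \<open>p 1\<close> is kept as it is.
      Its bound has no slack, and the slack \<open>n\<close> allowed for \<open>p 0\<close> makes up
      for the missing variable.\<close>
    from IH[OF l'] obtain D where D: "\<forall>n>0. \<exists>(A :: nat list set) y. finite A \<and>
           n ^ k \<le> card A * (if l' = 0 then n else 1) \<and>
           (\<forall>a\<in>A. Poly_Mapping.keys (y a) \<subseteq> B (D * n)) \<and> indep (p 1) A y" ..
    show ?thesis
    proof (intro exI[of _ D] allI impI)
      fix n :: nat assume n: "n > 0"
      obtain A :: "nat list set" and y where A: "finite A"
           "n ^ k \<le> card A * (if l' = 0 then n else 1)"
           "\<forall>a\<in>A. Poly_Mapping.keys (y a) \<subseteq> B (D * n)" "indep (p 1) A y"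
        using D n by blast
      have "indep (p 0) A y"
        by (rule indep_char_zero[OF p(1,2) _ _ l' _ A(4) _ A(1)])
          (use True sub Suc.prems(3) A(3) keys_B_closed in auto)
      moreover have "n ^ Suc k \<le> card A * n"
        using A(2) True by (simp add: mult.commute)
      ultimately show "\<exists>(A :: nat list set) y. finite A \<and>
           n ^ Suc k \<le> card A * (if l = 0 then n else 1) \<and>
           (\<forall>a\<in>A. Poly_Mapping.keys (y a) \<subseteq> B (D * n)) \<and> indep (p 0) A y"
        using A True by (intro exI[of _ A] exI[of _ y]) simp
    qed
  next
    case False
    have l1: "residue_char (p 1) l"
    proof (cases "l = 0")
      case True
      with False l' show ?thesis by simp
    next
      case False
      then show ?thesis using residue_char_mono[OF p _ Suc.prems(3) l'] sub by blast
    qed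
    from IH[OF l1] obtain D where D: "\<forall>n>0. \<exists>(A :: nat list set) y. finite A \<and>
           n ^ k \<le> card A * (if l = 0 then n else 1) \<and>
           (\<forall>a\<in>A. Poly_Mapping.keys (y a) \<subseteq> B (D * n)) \<and> indep (p 1) A y" ..
    obtain L where L: "Poly_Mapping.keys z \<subseteq> B L" using ex_keys_B[OF zc] by blast
    show ?thesis
    \<comment> \<open>Powers of \<open>z\<close> with exponents below \<open>n\<close> have support
      in \<open>B (L * n)\<close>, which adds \<open>L\<close> to the constant.\<close>
    proof (intro exI[of _ "L + D"] allI impI)
      fix n :: nat assume n: "n > 0"
      obtain A :: "nat list set" and y where A: "finite A"
           "n ^ k \<le> card A * (if l = 0 then n else 1)"
           "\<forall>a\<in>A. Poly_Mapping.keys (y a) \<subseteq> B (D * n)" "indep (p 1) A y"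
        using D n by blast
      have y: "y a \<in> carrier R" if "a \<in> A" for a using A(3) that keys_B_closed by blast
      define C where "C = (\<lambda>(i, a). i # a) ` ({..<n} \<times> A)"
      define u where "u w = z [^]\<^bsub>R\<^esub> hd w \<otimes>\<^bsub>R\<^esub> y (tl w)" for w :: "nat list"
      have inj: "inj_on (\<lambda>(i, a). i # a) ({..<n} \<times> A)" by (auto simp: inj_on_def)
      have card: "card C = n * card A"
        unfolding C_def using inj by (simp add: card_image card_cartesian_product)
      have keys: "Poly_Mapping.keys (u w) \<subseteq> B ((L + D) * n)" if "w \<in> C" for w
      proof -
        obtain i a where w: "w = i # a" "i < n" "a \<in> A" using \<open>w \<in> C\<close> by (auto simp: C_def)
        have "Poly_Mapping.keys (u w) \<subseteq> B (L * i + D * n)"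
          unfolding u_def w using keys_B_mult keys_B_power[OF L] A(3) w by simp
        also have "\<dots> \<subseteq> B ((L + D) * n)"
          using w by (intro B_mono) (simp add: add_mult_distrib)
        finally show ?thesis .
      qed
      have "indep (p 0) C u"
        unfolding indep_def
      proof (intro allI impI ballI)
        fix c w assume c: "(\<Sum>w\<in>C. frag_cmul (c w) (u w)) \<in> p 0" and w: "w \<in> C"
        have "(\<Sum>w\<in>C. frag_cmul (c w) (u w))
            = (\<Sum>i<n. \<Sum>a\<in>A. frag_cmul (c (i # a)) (z [^]\<^bsub>R\<^esub> i \<otimes>\<^bsub>R\<^esub> y a))"
          unfolding C_def sum.reindex[OF inj] sum.cartesian_product
          by (intro sum.cong) (auto simp: u_def)
        also have "\<dots> = (\<Sum>i<n. z [^]\<^bsub>R\<^esub> i \<otimes>\<^bsub>R\<^esub> (\<Sum>a\<in>A. frag_cmul (c (i # a)) (y a)))"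
          using zc y by (intro sum.cong) (auto simp: mult_sum_right R_cmul_closed mult_cmul_right)
        finally have "\<forall>i<n. \<forall>a\<in>A. l dvd c (i # a)"
          using c indep_powers[OF p _ Suc.prems(3) l1 z A(4) y, where n = n and c = "\<lambda>i a. c (i # a)"] sub by simp
        then have "l dvd c w" using w by (auto simp: C_def)
        then show "frag_cmul (c w) \<one>\<^bsub>R\<^esub> \<in> p 0" using Suc.prems(3) by (simp add: residue_char_def)
      qed
      moreover have "finite C" using A(1) by (simp add: C_def)
      moreover have "n ^ Suc k \<le> card C * (if l = 0 then n else 1)"
        using A(2) card by (auto simp: mult.assoc)
      ultimately show "\<exists>(A :: nat list set) y. finite A \<and>
           n ^ Suc k \<le> card A * (if l = 0 then n else 1) \<and>
           (\<forall>a\<in>A. Poly_Mapping.keys (y a) \<subseteq> B ((L + D) * n)) \<and> indep (p 0) A y"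
        using keys by (intro exI[of _ C] exI[of _ u]) simp
    qed
  qed
qed

text \<open>Two group elements that span the same line modulo \<open>p\<close>. Both coefficients
  must be non-zero modulo \<open>l\<close>, so that non-zero multiples of elements on different
  lines are incongruent.\<close>

definition proportional :: "('a \<Rightarrow>\<^sub>0 int) set \<Rightarrow> int \<Rightarrow> 'a \<Rightarrow> 'a \<Rightarrow> bool" where
  "proportional p l s t \<longleftrightarrow>
     (\<exists>i j. \<not> l dvd i \<and> \<not> l dvd j \<and> frag_cmul i (frag_of s) - frag_cmul j (frag_of t) \<in> p)"

text \<open>Up to non-zero scalars, every element of \<open>W\<close> is congruent to an element of
  \<open>T\<close>. After clearing denominators the \<open>y a\<close> are combinations of
  \<open>T\<close>, and more than \<open>card T\<close> of them would be dependent by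
  \<open>int_elimination\<close>.\<close>

lemma card_indep_le_transversal:
  assumes p: "primeideal p R" and l: "residue_char p l"
    and W: "finite W" "W \<subseteq> carrier Q" and T: "T \<subseteq> W" "\<And>w. w \<in> W \<Longrightarrow> \<exists>t\<in>T. proportional p l w t"
    and A: "finite A" "\<And>a. a \<in> A \<Longrightarrow> Poly_Mapping.keys (y a) \<subseteq> W" "indep p A y"
  shows "card A \<le> card T"
proof (rule ccontr)
  assume "\<not> ?thesis"
  then have less: "card T < card A" by simp
  note I = prime_ideal[OF p]
  have finT: "finite T" using T(1) W(1) finite_subset by blast
  have "\<forall>w\<in>W. \<exists>t i j. t \<in> T \<and> \<not> l dvd i \<and> frag_cmul i (frag_of w) - frag_cmul j (frag_of t) \<in> p"
    using T(2) unfolding proportional_def by blast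
  then obtain \<tau> i j where \<tau>: "\<And>w. w \<in> W \<Longrightarrow> \<tau> w \<in> T" and i: "\<And>w. w \<in> W \<Longrightarrow> \<not> l dvd i w"
    and ij: "\<And>w. w \<in> W \<Longrightarrow> frag_cmul (i w) (frag_of w) - frag_cmul (j w) (frag_of (\<tau> w)) \<in> p"
    by metis
  \<comment> \<open>A common denominator for all of \<open>W\<close>; primality of \<open>l\<close>
    keeps it non-zero modulo \<open>l\<close>.\<close>
  define \<Delta> where "\<Delta> = prod i W"
  define \<delta> where "\<delta> w = prod i (W - {w})" for w
  have \<Delta>: "\<Delta> = \<delta> w * i w" if "w \<in> W" for w
    unfolding \<Delta>_def \<delta>_def using prod.remove[OF W(1) that, of i] by (simp add: mult.commute)
  have "\<not> l dvd prod i W'" if "finite W'" "W' \<subseteq> W" for W'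
    using that
  proof (induction W' rule: finite_induct)
    case (insert w W')
    then show ?case using residue_char_prime[OF p l, of "i w" "prod i W'"] i[of w] by auto
  qed (use residue_char_not_unit[OF p l] in simp)
  then have \<Delta>l: "\<not> l dvd \<Delta>" unfolding \<Delta>_def using W(1) by blast
  \<comment> \<open>The coordinates, with respect to \<open>T\<close> and modulo \<open>p\<close>,
    of \<open>\<Delta>\<close> times \<open>y a\<close>.\<close>
  define b where
    "b a t = (\<Sum>w\<in>{w \<in> W. \<tau> w = t}. Poly_Mapping.lookup (y a) w * \<delta> w * j w)" for a t
  have y\<Delta>: "frag_cmul \<Delta> (y a) - (\<Sum>t\<in>T. frag_cmul (b a t) (frag_of t)) \<in> p" if a: "a \<in> A" for a
  proof -
    define e where "e w = Poly_Mapping.lookup (y a) w * \<delta> w" for w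
    have "y a = (\<Sum>w\<in>Poly_Mapping.keys (y a). frag_cmul (Poly_Mapping.lookup (y a) w) (frag_of w))"
      using frag_expansion[of "y a"] by (simp add: frag_extend_def)
    also have "\<dots> = (\<Sum>w\<in>W. frag_cmul (Poly_Mapping.lookup (y a) w) (frag_of w))"
      using A(2)[OF a] W(1) by (intro sum.mono_neutral_left) (auto simp: in_keys_iff)
    finally have "frag_cmul \<Delta> (y a)
        = frag_cmul \<Delta> (\<Sum>w\<in>W. frag_cmul (Poly_Mapping.lookup (y a) w) (frag_of w))"
      by simp
    also have "\<dots> = (\<Sum>w\<in>W. frag_cmul (e w * i w) (frag_of w))"
      unfolding frag_cmul_sum by (intro sum.cong) (auto simp: \<Delta> e_def mult_ac)
    finally have 1: "frag_cmul \<Delta> (y a) = (\<Sum>w\<in>W. frag_cmul (e w * i w) (frag_of w))" .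
    have "(\<Sum>t\<in>T. frag_cmul (b a t) (frag_of t))
        = (\<Sum>t\<in>T. \<Sum>w\<in>{w \<in> W. \<tau> w = t}. frag_cmul (e w * j w) (frag_of (\<tau> w)))"
      unfolding b_def frag_cmul_sum_left by (intro sum.cong) (auto simp: e_def)
    also have "\<dots> = (\<Sum>w\<in>W. frag_cmul (e w * j w) (frag_of (\<tau> w)))"
      by (rule sum.group) (use W(1) finT \<tau> in auto)
    finally have 2: "(\<Sum>t\<in>T. frag_cmul (b a t) (frag_of t))
        = (\<Sum>w\<in>W. frag_cmul (e w * j w) (frag_of (\<tau> w)))" .
    have "frag_cmul (e w * i w) (frag_of w) - frag_cmul (e w * j w) (frag_of (\<tau> w)) \<in> p"
      if "w \<in> W" for w
    proof -
      have "frag_cmul (e w) (frag_cmul (i w) (frag_of w) - frag_cmul (j w) (frag_of (\<tau> w))) \<in> p"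
        using ideal_cmul[OF I ij[OF that]] .
      then show ?thesis
        by (simp add: frag_cmul_diff_distrib2)
    qed
    then show ?thesis
      unfolding 1 2 sum_subtractf[symmetric] by (rule ideal_sum[OF I])
  qed
  obtain c where c: "\<exists>a\<in>A. \<not> l dvd c a" "\<forall>t\<in>T. l dvd (\<Sum>a\<in>A. c a * b a t)"
    using int_elimination[OF residue_char_prime[OF p l] residue_char_not_unit[OF p l] finT A(1) less]
    by blast
  define s where "s = (\<Sum>a\<in>A. frag_cmul (c a) (y a))"
  have s: "s \<in> carrier R"
    unfolding s_def using A(2) W(2) by (intro R_sum_closed R_cmul_closed) (auto simp: carrier_R)
  have comb: "(\<Sum>a\<in>A. frag_cmul (c a) (frag_cmul \<Delta> (y a) - (\<Sum>t\<in>T. frag_cmul (b a t) (frag_of t)))) \<in> p"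
    by (intro ideal_sum[OF I] ideal_cmul[OF I] y\<Delta>)
  have "(\<Sum>a\<in>A. frag_cmul (c a) (\<Sum>t\<in>T. frag_cmul (b a t) (frag_of t)))
      = (\<Sum>t\<in>T. frag_cmul (\<Sum>a\<in>A. c a * b a t) (frag_of t))"
    unfolding frag_cmul_sum frag_cmul_sum_left by (subst sum.swap) simp
  also have "\<dots> \<in> p"
    using c(2) l T(1) W(2) frag_of_closed
    by (intro ideal_sum[OF I]) (auto simp: residue_char_cmul[OF p l] subset_iff)
  finally have "(\<Sum>a\<in>A. frag_cmul (c a) (\<Sum>t\<in>T. frag_cmul (b a t) (frag_of t))) \<in> p" .
  from ideal_add[OF I comb this] have "(\<Sum>a\<in>A. frag_cmul (c a) (frag_cmul \<Delta> (y a))) \<in> p"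
    by (simp add: frag_cmul_diff_distrib2 sum_subtractf)
  moreover have "(\<Sum>a\<in>A. frag_cmul (c a) (frag_cmul \<Delta> (y a))) = frag_cmul \<Delta> s"
    by (simp add: s_def frag_cmul_sum mult.commute)
  ultimately have "s \<in> p" using residue_char_cmul[OF p l s] \<Delta>l by simp
  then show False
    using A(3) c(1) l unfolding indep_def s_def residue_char_def by blast
qed

text \<open>The supports of the independent family lie in a ball, which therefore contains at least
  as many pairwise non-proportional group elements. In characteristic zero their multiples by
  \<open>1\<close> to \<open>n\<close> supply the factor \<open>n\<close> missing from the
  family.\<close>

lemma prime_chain_incongruent:
  fixes p :: "nat \<Rightarrow> ('a \<Rightarrow>\<^sub>0 int) set"
  assumes p: "\<And>i. i \<le> k \<Longrightarrow> primeideal (p i) R" "\<And>i. i < k \<Longrightarrow> p i \<subset> p (Suc i)"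
  shows "\<exists>D. \<forall>n>0. \<exists>F. F \<subseteq> {1..n} \<times> B (D * n) \<and> n ^ k \<le> card F \<and>
           (\<forall>(i, s)\<in>F. \<forall>(j, t)\<in>F. (i, s) \<noteq> (j, t) \<longrightarrow>
              frag_cmul (int i) (frag_of s) - frag_cmul (int j) (frag_of t) \<notin> p 0)"
proof -
  have p0: "primeideal (p 0) R" using p by blast
  note I = prime_ideal[OF p0]
  obtain l where l: "residue_char (p 0) l" using ex_residue_char[OF p0] by blast
  obtain D where D: "\<forall>n>0. \<exists>(A :: nat list set) y. finite A \<and>
           n ^ k \<le> card A * (if l = 0 then n else 1) \<and>
           (\<forall>a\<in>A. Poly_Mapping.keys (y a) \<subseteq> B (D * n)) \<and> indep (p 0) A y"
    using prime_chain_indep[OF p l] by blast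
  have not1: "\<not> l dvd 1" using residue_char_not_unit[OF p0 l] .
  show ?thesis
  proof (intro exI[of _ D] allI impI)
    fix n :: nat assume n: "n > 0"
    obtain A :: "nat list set" and y where A: "finite A"
         "n ^ k \<le> card A * (if l = 0 then n else 1)"
         "\<forall>a\<in>A. Poly_Mapping.keys (y a) \<subseteq> B (D * n)" "indep (p 0) A y"
      using D n by blast
    have refl: "proportional (p 0) l x x" for x
      unfolding proportional_def using not1 ideal_zero[OF I]
      by (intro exI[of _ 1]) simp
    have sym: "proportional (p 0) l y x" if xy: "proportional (p 0) l x y" for x y
    proof -
      obtain i j where "\<not> l dvd i" "\<not> l dvd j" "frag_cmul i (frag_of x) - frag_cmul j (frag_of y) \<in> p 0"
        using xy unfolding proportional_def by blast
      with ideal_uminus[OF I this(3)] show ?thesis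
        unfolding proportional_def minus_diff_eq by blast
    qed
    obtain T where T: "T \<subseteq> B (D * n)" "\<forall>s\<in>T. \<forall>t\<in>T. proportional (p 0) l s t \<longrightarrow> s = t"
      "\<forall>w\<in>B (D * n). \<exists>t\<in>T. proportional (p 0) l w t"
      using ex_transversal[of "B (D * n)" "proportional (p 0) l"] refl sym B_finite by blast
    have card: "card A \<le> card T"
      by (rule card_indep_le_transversal[OF p0 l B_finite B_subset T(1) _ A(1) _ A(4)]) (use T A(3) in auto)
    \<comment> \<open>Multipliers must not be divisible by \<open>l\<close>, and distinct ones must
      stay incongruent modulo \<open>l\<close>: in prime characteristic only \<open>1\<close> is
      used, and \<open>0\<close> is always left out.\<close>
    define J where "J = {1..(if l = 0 then n else 1)}"
    have "n ^ k \<le> card A * card J" using A(2) n by (simp add: J_def)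
    also have "\<dots> \<le> card (J \<times> T)" using card by (simp add: card_cartesian_product)
    finally have "n ^ k \<le> card (J \<times> T)" .
    moreover have "J \<times> T \<subseteq> {1..n} \<times> B (D * n)" using T(1) n by (auto simp: J_def)
    moreover have "frag_cmul (int i) (frag_of s) - frag_cmul (int j) (frag_of t) \<notin> p 0"
      if ij: "i \<in> J" "j \<in> J" "s \<in> T" "t \<in> T" "(i, s) \<noteq> (j, t)" for i j s t
    proof
      assume *: "frag_cmul (int i) (frag_of s) - frag_cmul (int j) (frag_of t) \<in> p 0"
      have nd: "\<not> l dvd int i" if "i \<in> J" for i using that not1 by (auto simp: J_def split: if_splits)
      \<comment> \<open>Congruent multiples make \<open>s\<close> and \<open>t\<close> proportional,
        hence equal; then \<open>i - j\<close> times a unit lies in \<open>p 0\<close>, which forces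
        \<open>i = j\<close>.\<close>
      have "s = t" using T(2) ij nd * unfolding proportional_def by blast
      then have "frag_cmul (int i - int j) (frag_of t) \<in> p 0"
        using * by (simp add: frag_cmul_diff_distrib)
      moreover have "t \<in> carrier Q" using ij T(1) B_subset by blast
      ultimately have "l dvd int i - int j"
        using residue_char_cmul[OF p0 l] frag_of_closed frag_of_notin_prime[OF p0] by blast
      then have "i = j" using ij by (auto simp: J_def split: if_splits)
      then show False using ij \<open>s = t\<close> by simp
    qed
    ultimately show "\<exists>F. F \<subseteq> {1..n} \<times> B (D * n) \<and> n ^ k \<le> card F \<and>
           (\<forall>(i, s)\<in>F. \<forall>(j, t)\<in>F. (i, s) \<noteq> (j, t) \<longrightarrow>
              frag_cmul (int i) (frag_of s) - frag_cmul (int j) (frag_of t) \<notin> p 0)"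
      by (intro exI[of _ "J \<times> T"]) blast
  qed
qed

end

section \<open>Finite normal generation\<close>

lemma (in group) subgroup_centralizer:
  assumes "a \<in> carrier G"
  shows "subgroup {x \<in> carrier G. x \<otimes> a = a \<otimes> x} G"
proof (rule subgroupI)
  fix x assume "x \<in> {x \<in> carrier G. x \<otimes> a = a \<otimes> x}"
  then have x: "x \<in> carrier G" "x \<otimes> a = a \<otimes> x" by auto
  have "inv x \<otimes> a = inv x \<otimes> (a \<otimes> x) \<otimes> inv x" using x(1) assms by (simp add: m_assoc)
  also have "\<dots> = inv x \<otimes> (x \<otimes> a) \<otimes> inv x" by (simp only: x(2))
  also have "\<dots> = a \<otimes> inv x" using x(1) assms by (simp flip: m_assoc)
  finally show "inv x \<in> {x \<in> carrier G. x \<otimes> a = a \<otimes> x}" using x by simp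
next
  fix x y assume "x \<in> {x \<in> carrier G. x \<otimes> a = a \<otimes> x}" "y \<in> {x \<in> carrier G. x \<otimes> a = a \<otimes> x}"
  then show "x \<otimes> y \<in> {x \<in> carrier G. x \<otimes> a = a \<otimes> x}"
    using assms by (simp add: m_assoc) (simp flip: m_assoc)
qed (use assms in auto)

lemma (in group) comm_group_if_generators_commute:
  assumes "S \<subseteq> carrier G" "generate G S = carrier G"
    and comm: "\<And>s t. s \<in> S \<Longrightarrow> t \<in> S \<Longrightarrow> s \<otimes> t = t \<otimes> s"
  shows "comm_group G"
proof (rule group_comm_groupI)
  have *: "carrier G \<subseteq> {x \<in> carrier G. x \<otimes> a = a \<otimes> x}"
    if "a \<in> carrier G" "\<And>s. s \<in> S \<Longrightarrow> s \<otimes> a = a \<otimes> s" for a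
    using generate_subgroup_incl[OF _ subgroup_centralizer[OF that(1)], of S] assms that by blast
  have "x \<otimes> s = s \<otimes> x" if "x \<in> carrier G" "s \<in> S" for x s
    using *[of s] that assms by blast
  then show "x \<otimes> y = y \<otimes> x" if "x \<in> carrier G" "y \<in> carrier G" for x y
    using *[of y] that by fastforce
qed

lemma (in group) derived_subset_if_quotient_comm:
  assumes "H \<lhd> G" "comm_group (G Mod H)"
  shows "derived G (carrier G) \<subseteq> H"
  unfolding derived_def
proof (rule generate_subgroup_incl)
  interpret H: normal H G by fact
  interpret K: comm_group "G Mod H" by fact
  have hom: "(\<lambda>a. H #> a) \<in> hom G (G Mod H)" by (rule H.r_coset_hom_Mod)
  interpret h: group_hom G "G Mod H" "\<lambda>a. H #> a"
    using hom by (intro group_hom.intro group_hom_axioms.intro) (rule group_axioms K.is_group)+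
  show "derived_set G (carrier G) \<subseteq> H"
  proof
    fix c assume "c \<in> derived_set G (carrier G)"
    then obtain x y where xy: "x \<in> carrier G" "y \<in> carrier G" "c = x \<otimes> y \<otimes> inv x \<otimes> inv y"
      by auto
    have "H #> c = (H #> x) \<otimes>\<^bsub>G Mod H\<^esub> (H #> y) \<otimes>\<^bsub>G Mod H\<^esub> inv\<^bsub>G Mod H\<^esub> (H #> x) \<otimes>\<^bsub>G Mod H\<^esub> inv\<^bsub>G Mod H\<^esub> (H #> y)"
      using xy by (simp only: h.hom_mult h.hom_inv m_closed inv_closed)
    also have "\<dots> = \<one>\<^bsub>G Mod H\<^esub>"
    proof -
      have c: "H #> x \<in> carrier (G Mod H)" "H #> y \<in> carrier (G Mod H)"
        using h.hom_closed xy by auto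
      have "(H #> x) \<otimes>\<^bsub>G Mod H\<^esub> (H #> y) \<otimes>\<^bsub>G Mod H\<^esub> inv\<^bsub>G Mod H\<^esub> (H #> x) = H #> y"
        unfolding K.m_comm[OF c] using c by (simp only: K.m_assoc K.inv_closed K.r_inv K.r_one)
      then show ?thesis using K.r_inv[OF c(2)] by (simp only:)
    qed
    also have "\<dots> = H" by (simp add: FactGroup_def)
    finally show "c \<in> H"
      using coset_join1[OF _ _ H.is_subgroup] xy by simp
  qed
qed (use assms(1) in \<open>simp add: normal_imp_subgroup\<close>)

section \<open>Subgroups of finitely generated abelian groups\<close>

lemma (in comm_group) generate_insert_subset:
  assumes "s \<in> carrier G" "Y \<subseteq> carrier G"
  shows "generate G (insert s Y) \<subseteq> {s [^] (e::int) \<otimes> g | e g. g \<in> generate G Y}" (is "_ \<subseteq> ?P")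
proof (rule generate_subgroup_incl)
  note K = generate_is_subgroup[OF assms(2)]
  have Kc: "g \<in> carrier G" if "g \<in> generate G Y" for g using generate_incl[OF assms(2)] that by blast
  have "s \<in> ?P" using assms(1) subgroup.one_closed[OF K] by (auto intro!: exI[of _ 1] exI[of _ \<one>])
  moreover have "x \<in> ?P" if "x \<in> Y" for x
    using assms(2) that generate.incl[OF that] by (auto intro!: exI[of _ 0] exI[of _ x])
  ultimately show "insert s Y \<subseteq> ?P" by blast
  show "subgroup ?P G"
  proof (rule subgroupI)
    show "?P \<subseteq> carrier G" using assms(1) Kc by auto
    show "?P \<noteq> {}" using subgroup.one_closed[OF K] by blast
  next
    fix x assume "x \<in> ?P"
    then obtain e :: int and g where x: "x = s [^] e \<otimes> g" "g \<in> generate G Y" by blast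
    have "inv x = s [^] (- e) \<otimes> inv g"
      using x Kc assms(1) by (simp add: inv_mult int_pow_neg)
    then show "inv x \<in> ?P" using subgroup.m_inv_closed[OF K x(2)] by blast
  next
    fix x y assume "x \<in> ?P" "y \<in> ?P"
    then obtain e e' :: int and g g' where x: "x = s [^] e \<otimes> g" "g \<in> generate G Y"
      and y: "y = s [^] e' \<otimes> g'" "g' \<in> generate G Y" by blast
    have "x \<otimes> y = s [^] (e + e') \<otimes> (g \<otimes> g')"
      using x y Kc assms(1) by (simp add: int_pow_mult m_ac)
    then show "x \<otimes> y \<in> ?P" using subgroup.m_closed[OF K x(2) y(2)] by blast
  qed
qed

text \<open>Induction on the number of generators. The exponents of \<open>s\<close> in elements of
  \<open>H\<close> are the multiples of some \<open>l\<close>; an element of \<open>H\<close> with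
  exponent \<open>l\<close>, together with generators of the part of \<open>H\<close> inside
  \<open>generate G Y\<close>, generates \<open>H\<close>.\<close>

lemma (in comm_group) subgroup_finitely_generated:
  assumes "finite Y" "Y \<subseteq> carrier G" "subgroup H G" "H \<subseteq> generate G Y"
  shows "\<exists>F. finite F \<and> F \<subseteq> H \<and> H \<subseteq> generate G F"
  using assms
proof (induction Y arbitrary: H rule: finite_induct)
  case empty
  then show ?case by (intro exI[of _ "{}"]) auto
next
  case (insert s Y)
  have s: "s \<in> carrier G" and Y: "Y \<subseteq> carrier G" using insert.prems by auto
  note H = insert.prems(2) and K = generate_is_subgroup[OF Y]
  have Kc: "g \<in> carrier G" if "g \<in> generate G Y" for g using generate_incl[OF Y] that by blast
  have Hc: "h \<in> carrier G" if "h \<in> H" for h using subgroup.subset[OF H] that by blast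
  define Z where "Z = {e :: int. \<exists>g\<in>generate G Y. s [^] e \<otimes> g \<in> H}"
  have "\<exists>l. Z = {c. l dvd c}"
  proof (rule int_additive_subgroup_principal)
    show "0 \<in> Z" unfolding Z_def
      using subgroup.one_closed[OF K] subgroup.one_closed[OF H] by (auto intro!: bexI[of _ \<one>])
  next
    fix x y assume "x \<in> Z" "y \<in> Z"
    then obtain g g' where g: "g \<in> generate G Y" "s [^] x \<otimes> g \<in> H"
      and g': "g' \<in> generate G Y" "s [^] y \<otimes> g' \<in> H" unfolding Z_def by blast
    have "s [^] x \<otimes> g \<otimes> inv (s [^] y \<otimes> g') = s [^] (x - y) \<otimes> (g \<otimes> inv g')"
      using g g' Kc s by (simp add: inv_mult int_pow_diff m_ac)
    moreover have "s [^] x \<otimes> g \<otimes> inv (s [^] y \<otimes> g') \<in> H"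
      using g g' H by (simp add: subgroup.m_closed subgroup.m_inv_closed)
    moreover have "g \<otimes> inv g' \<in> generate G Y"
      using g g' K by (simp add: subgroup.m_closed subgroup.m_inv_closed)
    ultimately show "x - y \<in> Z" unfolding Z_def by auto
  next
    fix x y assume "x \<in> Z"
    then obtain g where g: "g \<in> generate G Y" "s [^] x \<otimes> g \<in> H" unfolding Z_def by blast
    have "(s [^] x \<otimes> g) [^] y = s [^] (y * x) \<otimes> g [^] y"
      using g Kc s by (simp add: int_pow_distrib int_pow_pow mult.commute)
    moreover have "(s [^] x \<otimes> g) [^] y \<in> H" by (rule subgroup_int_pow_closed[OF H g(2)])
    moreover have "g [^] y \<in> generate G Y" by (rule subgroup_int_pow_closed[OF K g(1)])
    ultimately show "y * x \<in> Z" unfolding Z_def by auto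
  qed
  then obtain l where l: "Z = {c. l dvd c}" by blast
  then have "l \<in> Z" by simp
  then obtain g0 where g0: "g0 \<in> generate G Y" "s [^] l \<otimes> g0 \<in> H" unfolding Z_def by blast
  define h where "h = s [^] l \<otimes> g0"
  have "subgroup (H \<inter> generate G Y) G" using H K by (rule subgroups_Inter_pair)
  from insert.IH[OF Y this] obtain F where F: "finite F" "F \<subseteq> H" "H \<inter> generate G Y \<subseteq> generate G F"
    by auto
  have F': "insert h F \<subseteq> carrier G" using F(2) g0(2) Hc by (auto simp: h_def)
  note J = generate_is_subgroup[OF F']
  have "x \<in> generate G (insert h F)" if x: "x \<in> H" for x
  proof -
    obtain e :: int and g where e: "x = s [^] e \<otimes> g" "g \<in> generate G Y"
      using generate_insert_subset[OF s Y] insert.prems(3) x by blast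
    then have "e \<in> Z" unfolding Z_def using x by auto
    then obtain q where q: "e = l * q" using l by auto
    have hq: "h [^] q = s [^] e \<otimes> g0 [^] q"
      unfolding h_def q using g0 Kc s by (simp add: int_pow_distrib int_pow_pow)
    have "x \<otimes> inv (h [^] q) = g \<otimes> inv (g0 [^] q)"
      unfolding hq e(1) using e(2) g0(1) Kc s by (simp add: inv_mult m_ac flip: m_assoc)
    moreover have "x \<otimes> inv (h [^] q) \<in> H"
      using x H g0(2) subgroup_int_pow_closed[OF H g0(2)]
      by (simp add: subgroup.m_closed subgroup.m_inv_closed h_def)
    moreover have "g \<otimes> inv (g0 [^] q) \<in> generate G Y"
      using e(2) K subgroup_int_pow_closed[OF K g0(1)]
      by (simp add: subgroup.m_closed subgroup.m_inv_closed)
    ultimately have "x \<otimes> inv (h [^] q) \<in> generate G (insert h F)"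
      using F(3) mono_generate[of F "insert h F"] by auto
    moreover have "h [^] q \<in> generate G (insert h F)"
      by (intro subgroup_int_pow_closed[OF J] generate.incl) simp
    ultimately have "x \<otimes> inv (h [^] q) \<otimes> h [^] q \<in> generate G (insert h F)"
      using subgroup.m_closed[OF J] by blast
    then show ?thesis using Hc[OF x] F' by (simp add: m_assoc)
  qed
  then show ?case using F g0(2) by (intro exI[of _ "insert h F"]) (auto simp: h_def)
qed

text \<open>The image of \<open>N\<close> modulo the derived subgroup \<open>P\<close> is a subgroup
  of a finitely generated abelian group, and \<open>P\<close> is the normal closure of the
  commutators of the generators. In terms of the conjugation module, \<open>M\<close> is a finite
  set of module generators.\<close>

lemma (in group) abelian_extension_normally_finitely_generated:
  assumes S: "finite S" "S \<subseteq> carrier G" "generate G S = carrier G"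
    and N: "N \<lhd> G" "comm_group (G Mod N)"
  shows "\<exists>M. finite M \<and> M \<subseteq> N \<and> (\<forall>H. H \<lhd> G \<longrightarrow> M \<subseteq> H \<longrightarrow> N \<subseteq> H)"
proof -
  interpret N: normal N G by fact
  define P where "P = derived G (carrier G)"
  have PN: "P \<subseteq> N" unfolding P_def by (rule derived_subset_if_quotient_comm[OF N])
  interpret P: normal P G unfolding P_def by (rule derived_self_is_normal)
  interpret A: comm_group "G Mod P" unfolding P_def by (rule derived_quot_is_comm_group)
  interpret h: group_hom G "G Mod P" "\<lambda>a. P #> a"
    using P.r_coset_hom_Mod by (intro group_hom.intro group_hom_axioms.intro) (rule group_axioms A.is_group)+
  have gen: "generate (G Mod P) ((\<lambda>a. P #> a) ` S) = carrier (G Mod P)"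
    unfolding h.generate_img[OF S(2)] S(3) by (auto simp: carrier_FactGroup)
  have N_img: "subgroup ((\<lambda>a. P #> a) ` N) (G Mod P)"
    by (rule h.subgroup_img_is_subgroup[OF N.is_subgroup])
  have N_gen: "(\<lambda>a. P #> a) ` N \<subseteq> generate (G Mod P) ((\<lambda>a. P #> a) ` S)"
    unfolding gen using h.hom_closed N.subset by blast
  have S_img: "(\<lambda>a. P #> a) ` S \<subseteq> carrier (G Mod P)" using S(2) h.hom_closed by blast
  obtain F' where F': "finite F'" "F' \<subseteq> (\<lambda>a. P #> a) ` N"
    "(\<lambda>a. P #> a) ` N \<subseteq> generate (G Mod P) F'"
    using A.subgroup_finitely_generated[OF finite_imageI[OF S(1)] S_img N_img N_gen] by blast
  obtain F where F: "F \<subseteq> N" "finite F" "F' = (\<lambda>a. P #> a) ` F"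
    using finite_subset_image[OF F'(1,2)] by blast
  \<comment> \<open>Commutators of generators, which normally generate \<open>P\<close>, and lifts
    of generators of the image of \<open>N\<close> modulo \<open>P\<close>.\<close>
  define M where "M = (\<lambda>(s, t). s \<otimes> t \<otimes> inv s \<otimes> inv t) ` (S \<times> S) \<union> F"
  have "s \<otimes> t \<otimes> inv s \<otimes> inv t \<in> P" if "s \<in> S" "t \<in> S" for s t
    unfolding P_def derived_def using that S(2) by (intro generate.incl) auto
  then have "M \<subseteq> N" unfolding M_def using F(1) PN by auto
  moreover have "finite M" unfolding M_def using S(1) F(2) by simp
  moreover have "N \<subseteq> H" if H: "H \<lhd> G" "M \<subseteq> H" for H
  proof -
    interpret H: normal H G by fact
    interpret K: group "G Mod H" by (rule H.factorgroup_is_group)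
    interpret k: group_hom G "G Mod H" "\<lambda>a. H #> a"
      using H.r_coset_hom_Mod by (intro group_hom.intro group_hom_axioms.intro) (rule group_axioms K.is_group)+
    \<comment> \<open>Modulo \<open>H\<close> the generators commute, so the quotient is abelian and
      \<open>P\<close> lies in \<open>H\<close>.\<close>
    have "comm_group (G Mod H)"
    proof (rule K.comm_group_if_generators_commute)
      show "(\<lambda>a. H #> a) ` S \<subseteq> carrier (G Mod H)" using S(2) k.hom_closed by blast
      show "generate (G Mod H) ((\<lambda>a. H #> a) ` S) = carrier (G Mod H)"
        unfolding k.generate_img[OF S(2)] S(3) by (auto simp: carrier_FactGroup)
      fix u v assume "u \<in> (\<lambda>a. H #> a) ` S" "v \<in> (\<lambda>a. H #> a) ` S"
      then obtain s t where st: "s \<in> S" "t \<in> S" "u = H #> s" "v = H #> t" by blast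
      then have c: "s \<in> carrier G" "t \<in> carrier G" using S(2) by auto
      have "s \<otimes> t \<otimes> inv s \<otimes> inv t \<in> H" using H(2) st unfolding M_def by auto
      moreover have "s \<otimes> t \<otimes> inv s \<otimes> inv t \<otimes> (t \<otimes> s) = s \<otimes> t"
        using c by (simp add: m_assoc inv_solve_left')
      ultimately have "s \<otimes> t \<in> H #> (t \<otimes> s)" unfolding r_coset_def by force
      then have "H #> (s \<otimes> t) = H #> (t \<otimes> s)"
        using repr_independence[OF _ m_closed[OF c(2,1)] H.is_subgroup, symmetric] by blast
      then show "u \<otimes>\<^bsub>G Mod H\<^esub> v = v \<otimes>\<^bsub>G Mod H\<^esub> u"
        using k.hom_mult[OF c] k.hom_mult[OF c(2,1)] by (simp only: st(3,4))
    qed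
    then have PH: "P \<subseteq> H" unfolding P_def by (rule derived_subset_if_quotient_comm[OF H(1)])
    have FG: "generate G F \<subseteq> H"
      using H(2) by (intro generate_subgroup_incl[OF _ H.is_subgroup]) (auto simp: M_def)
    have Fc: "F \<subseteq> carrier G" using F(1) N.subset by blast
    show "N \<subseteq> H"
    proof
      fix n assume n: "n \<in> N"
      then have "P #> n \<in> (\<lambda>a. P #> a) ` generate G F"
        using F'(3) unfolding F(3) h.generate_img[OF Fc] by blast
      then obtain m where m: "m \<in> generate G F" "P #> n = P #> m" by blast
      have "n \<in> P #> m" using rcos_self[OF _ P.is_subgroup, of n] n N.mem_carrier m(2) by simp
      then obtain p where "p \<in> P" "n = p \<otimes> m" unfolding r_coset_def by blast
      then show "n \<in> H" using PH FG m(1) H.m_closed by blast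
    qed
  qed
  ultimately show ?thesis by blast
qed

section \<open>Word length\<close>

locale group_generators = group +
  fixes S
  assumes S: "symmetric_generating_set G S"
begin

lemma S_subset: "S \<subseteq> carrier G"
  using S by (simp add: symmetric_generating_set_def)

definition eval_word :: "'a list \<Rightarrow> 'a" where
  "eval_word w = foldr (\<otimes>) w \<one>"

lemma eval_word_simps [simp]: "eval_word [] = \<one>" "eval_word (s # w) = s \<otimes> eval_word w"
  by (simp_all add: eval_word_def)

lemma eval_word_closed: "set w \<subseteq> S \<Longrightarrow> eval_word w \<in> carrier G"
  using S_subset by (induction w) auto

lemma eval_word_append:
  "set v \<subseteq> S \<Longrightarrow> set w \<subseteq> S \<Longrightarrow> eval_word (v @ w) = eval_word v \<otimes> eval_word w"
  using S_subset by (induction v) (auto simp: m_assoc eval_word_closed)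

lemma eval_word_inv:
  "set w \<subseteq> S \<Longrightarrow> \<exists>v. set v \<subseteq> S \<and> length v = length w \<and> eval_word v = inv (eval_word w)"
proof (induction w)
  case (Cons s w)
  then obtain v where v: "set v \<subseteq> S" "length v = length w" "eval_word v = inv (eval_word w)" by auto
  have s: "inv s \<in> S" "s \<in> carrier G"
    using S Cons.prems S_subset by (auto simp: symmetric_generating_set_def)
  then have "eval_word (v @ [inv s]) = inv (eval_word (s # w))"
    using v Cons.prems by (simp add: eval_word_append inv_mult_group eval_word_closed)
  with v s show ?case by (intro exI[of _ "v @ [inv s]"]) simp
qed simp

lemma ex_eval_word: "g \<in> carrier G \<Longrightarrow> \<exists>w. set w \<subseteq> S \<and> eval_word w = g"
proof -
  assume "g \<in> carrier G"
  then have "g \<in> generate G S" using S by (simp add: symmetric_generating_set_def)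
  then show ?thesis
  proof induction
    case one
    show ?case by (intro exI[of _ "[]"]) simp
  next
    case (incl h)
    then show ?case using S_subset by (intro exI[of _ "[h]"]) auto
  next
    case (inv h)
    then show ?case
      using S S_subset by (intro exI[of _ "[inv h]"]) (auto simp: symmetric_generating_set_def)
  next
    case (eng h1 h2)
    then obtain v w where "set v \<subseteq> S" "eval_word v = h1" "set w \<subseteq> S" "eval_word w = h2" by blast
    then show ?case by (intro exI[of _ "v @ w"]) (simp add: eval_word_append)
  qed
qed

lemma word_length_le: "set w \<subseteq> S \<Longrightarrow> word_length G S (eval_word w) \<le> length w"
  unfolding word_length_def eval_word_def by (rule Least_le) blast

lemma word_length_witness:
  assumes "g \<in> carrier G"
  obtains w where "set w \<subseteq> S" "length w = word_length G S g" "eval_word w = g"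
proof -
  obtain v where "set v \<subseteq> S" "eval_word v = g" using ex_eval_word[OF assms] by blast
  then have "\<exists>w. set w \<subseteq> S \<and> length w = length v \<and> foldr (\<otimes>) w \<one> = g"
    by (auto simp: eval_word_def)
  from LeastI[of "\<lambda>n. \<exists>w. set w \<subseteq> S \<and> length w = n \<and> foldr (\<otimes>) w \<one> = g", OF this]
  show ?thesis using that by (auto simp: word_length_def eval_word_def)
qed

lemma word_length_one: "word_length G S \<one> = 0"
  using word_length_le[of "[]"] by simp

lemma word_length_mult:
  assumes "g \<in> carrier G" "h \<in> carrier G"
  shows "word_length G S (g \<otimes> h) \<le> word_length G S g + word_length G S h"
proof -
  obtain v where v: "set v \<subseteq> S" "length v = word_length G S g" "eval_word v = g"
    using word_length_witness[OF assms(1)] .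
  obtain w where w: "set w \<subseteq> S" "length w = word_length G S h" "eval_word w = h"
    using word_length_witness[OF assms(2)] .
  show ?thesis using word_length_le[of "v @ w"] v w by (simp add: eval_word_append)
qed

lemma word_length_inv:
  assumes "g \<in> carrier G"
  shows "word_length G S (inv g) \<le> word_length G S g"
proof -
  obtain v where v: "set v \<subseteq> S" "length v = word_length G S g" "eval_word v = g"
    using word_length_witness[OF assms(1)] .
  obtain w where "set w \<subseteq> S" "length w = length v" "eval_word w = inv g"
    using eval_word_inv[OF v(1)] v(3) by blast
  then show ?thesis using word_length_le[of w] v by simp
qed

lemma word_length_pow:
  assumes "g \<in> carrier G"
  shows "word_length G S (g [^] (n::nat)) \<le> n * word_length G S g"
proof (induction n)
  case (Suc n)
  then show ?case using word_length_mult[of "g [^] n" g] assms by simp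
qed (simp add: word_length_one)

definition ball :: "nat \<Rightarrow> 'a set" where
  "ball n = {g \<in> carrier G. word_length G S g \<le> n}"

lemma finite_ball: "finite S \<Longrightarrow> finite (ball n)"
proof -
  assume "finite S"
  then have "finite (eval_word ` {w. set w \<subseteq> S \<and> length w \<le> n})"
    by (intro finite_imageI finite_lists_length_le)
  moreover have "ball n \<subseteq> eval_word ` {w. set w \<subseteq> S \<and> length w \<le> n}"
  proof
    fix g assume "g \<in> ball n"
    then have g: "g \<in> carrier G" "word_length G S g \<le> n" by (auto simp: ball_def)
    obtain w where "set w \<subseteq> S" "length w = word_length G S g" "eval_word w = g"
      using word_length_witness[OF g(1)] .
    then show "g \<in> eval_word ` {w. set w \<subseteq> S \<and> length w \<le> n}" using g(2) by (intro image_eqI[of _ _ w]) auto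
  qed
  ultimately show ?thesis by (rule rev_finite_subset)
qed

text \<open>For finite \<open>S\<close> the size of the ball bounds all cardinalities, so
  \<open>Max\<close> is taken over a finite set even when \<open>E\<close> is infinite.\<close>

lemma card_orbit_le_action_growth:
  assumes "finite S" "x \<in> E"
  shows "card ((\<lambda>g. \<phi> g x) ` ball n) \<le> action_growth G S E \<phi> n"
proof -
  let ?c = "\<lambda>x. card {\<phi> g x | g. g \<in> carrier G \<and> word_length G S g \<le> n}"
  have eq: "{\<phi> g x | g. g \<in> carrier G \<and> word_length G S g \<le> n} = (\<lambda>g. \<phi> g x) ` ball n" for x
    by (auto simp: ball_def)
  have "?c ` E \<subseteq> {..card (ball n)}"
    unfolding eq using card_image_le[OF finite_ball[OF assms(1)]] by auto
  then have "finite (?c ` E)" by (rule finite_subset) simp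
  then show ?thesis unfolding action_growth_def eq using assms(2) by (intro Max_ge) auto
qed

end

section \<open>The conjugation module and a faithful action\<close>

text \<open>Applied to subgroups of \<open>N\<close>, to the complement of a prime ideal and to the
  scalars that preserve a given subgroup.\<close>

lemma (in comm_monoid) finprod_in_submonoid:
  assumes "H \<subseteq> carrier G" "\<one> \<in> H" "\<And>x y. x \<in> H \<Longrightarrow> y \<in> H \<Longrightarrow> x \<otimes> y \<in> H"
    and "\<And>i. i \<in> I \<Longrightarrow> f i \<in> H"
  shows "finprod G f I \<in> H"
  using assms(4)
proof (induction I rule: infinite_finite_induct)
  case (insert i I)
  then have "f i \<in> carrier G" "f \<in> I \<rightarrow> carrier G" using assms(1) by auto
  with insert show ?case using assms(3) by (simp add: finprod_insert)
qed (use assms(2) in auto)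

locale abelian_extension_action = faithful_action +
  fixes N
  assumes ext: "abelian_extension G N"
begin

sublocale group G
  using group_hom by (rule group_hom.axioms)

sublocale N: normal N G
  using ext by (simp add: abelian_extension_def)

sublocale NG: comm_group "G\<lparr>carrier := N\<rparr>"
  using ext by (simp add: abelian_extension_def)

sublocale Q: abelian_group_ring "G Mod N"
  unfolding abelian_group_ring_def using ext by (simp add: abelian_extension_def)

sublocale M: Module.module "int_group_ring (G Mod N)" "conj_module G N"
  by (rule conj_module_module[OF ext])

abbreviation ZQ where "ZQ \<equiv> int_group_ring (G Mod N)"
abbreviation smul (infixr \<open>\<bullet>\<close> 75) where "a \<bullet> v \<equiv> a \<odot>\<^bsub>conj_module G N\<^esub> v"

section \<open>Scalars of the group ring acting on \<open>N\<close>\<close>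

lemma coset_carrier: "g \<in> carrier G \<Longrightarrow> N #> g \<in> carrier (G Mod N)"
  by (auto simp: carrier_FactGroup)

lemma smul_closed: "a \<in> carrier ZQ \<Longrightarrow> v \<in> N \<Longrightarrow> a \<bullet> v \<in> N"
  using M.smult_closed by (simp add: conj_module_simps(1))

lemma smul_assoc: "a \<in> carrier ZQ \<Longrightarrow> b \<in> carrier ZQ \<Longrightarrow> v \<in> N \<Longrightarrow> (a \<otimes>\<^bsub>ZQ\<^esub> b) \<bullet> v = a \<bullet> b \<bullet> v"
  using M.smult_assoc1 by (simp add: conj_module_simps(1))

lemma smul_mult: "a \<in> carrier ZQ \<Longrightarrow> v \<in> N \<Longrightarrow> w \<in> N \<Longrightarrow> a \<bullet> (v \<otimes> w) = (a \<bullet> v) \<otimes> (a \<bullet> w)"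
  using M.smult_r_distr by (simp add: conj_module_simps(1,3))

lemma smul_one: "a \<in> carrier ZQ \<Longrightarrow> a \<bullet> \<one> = \<one>"
  using M.smult_r_null by (simp add: conj_module_simps(2))

lemma smul_add:
  "a \<in> carrier ZQ \<Longrightarrow> b \<in> carrier ZQ \<Longrightarrow> v \<in> N \<Longrightarrow> (a + b) \<bullet> v = (a \<bullet> v) \<otimes> (b \<bullet> v)"
  using M.smult_l_distr[of a b v] by (simp add: conj_module_simps(1,3) Q.R_add)

lemma smul_diff:
  assumes "a \<in> carrier ZQ" "b \<in> carrier ZQ" "v \<in> N"
  shows "(a - b) \<bullet> v = (a \<bullet> v) \<otimes> inv (b \<bullet> v)"
proof -
  have "a \<bullet> v = ((a - b) \<bullet> v) \<otimes> (b \<bullet> v)"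
    using smul_add[of "a - b" b v] assms Q.R_diff_closed by simp
  then show ?thesis
    using smul_closed assms Q.R_diff_closed N.mem_carrier by (simp add: inv_solve_right)
qed

text \<open>Translates the action of a scalar \<open>j q\<close> into a product in \<open>G\<close>,
  whose word length can be bounded.\<close>

lemma smul_monomial:
  assumes "g \<in> carrier G" "v \<in> N"
  shows "frag_cmul (int j) (frag_of (N #> g)) \<bullet> v = g \<otimes> v [^] j \<otimes> inv g"
\<comment> \<open>For \<open>j = 0\<close> the scalar vanishes and has empty support; otherwise its
  support is a single coset.\<close>
proof (cases "j = 0")
  case True
  then show ?thesis using assms by (simp add: conj_module_simps(4))
next
  case False
  have c: "g \<otimes> v \<otimes> inv g \<in> N" using assms by (simp add: N.inv_op_closed2)
  have "(g \<otimes> v \<otimes> inv g) [^] j = g \<otimes> v [^] j \<otimes> inv g"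
  proof (induction j)
    case (Suc j)
    have "g \<otimes> v [^] j \<otimes> inv g \<otimes> (g \<otimes> v \<otimes> inv g) = g \<otimes> (v [^] j \<otimes> v) \<otimes> inv g"
      using assms N.mem_carrier by (simp add: m_assoc inv_solve_left')
    with Suc show ?case by simp
  qed (use assms in simp)
  moreover have "g \<otimes> v [^] j \<otimes> inv g \<in> N"
    using calculation subgroup_int_pow_closed[OF N.is_subgroup c, of "int j"]
    by (simp add: int_pow_int)
  moreover have "Poly_Mapping.keys (frag_cmul (int j) (frag_of (N #> g))) = {N #> g}"
    using False by auto
  ultimately show ?thesis
    using assms by (simp add: conj_module_simps(4) coset_conj_eq[OF ext] int_pow_int)
qed

text \<open>\<open>a \<bullet> v\<close> is a product of integer powers of conjugates of
  \<open>v\<close> by elements of the support of \<open>a\<close>. Read contrapositively, this finds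
  a conjugate of \<open>v\<close> outside \<open>H\<close>.\<close>

lemma smul_in_subgroup:
  assumes H: "subgroup H G" "H \<subseteq> N"
    and conj: "\<And>g. N #> g \<in> Poly_Mapping.keys a \<Longrightarrow> g \<in> carrier G \<Longrightarrow> g \<otimes> v \<otimes> inv g \<in> H"
    and a: "a \<in> carrier ZQ" and v: "v \<in> N"
  shows "a \<bullet> v \<in> H"
  unfolding conj_module_simps(4)
proof (rule NG.finprod_in_submonoid)
  fix q assume q: "q \<in> Poly_Mapping.keys a"
  then obtain g where "g \<in> carrier G" "q = N #> g"
    using a by (auto simp: Q.carrier_R carrier_FactGroup)
  with q conj v have "coset_conj G q v \<in> H" by (simp add: coset_conj_eq[OF ext])
  then show "coset_conj G q v [^] Poly_Mapping.lookup a q \<in> H"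
    by (rule subgroup_int_pow_closed[OF H(1)])
qed (use H subgroup.one_closed subgroup.m_closed in auto)

lemma commutator_in_N: "x \<in> carrier G \<Longrightarrow> y \<in> carrier G \<Longrightarrow> x \<otimes> y \<otimes> inv x \<otimes> inv y \<in> N"
  using derived_subset_if_quotient_comm[OF N.normal_axioms Q.comm_group_axioms]
  unfolding derived_def by (blast intro: generate.incl)

lemma annihilator_ideal: "ideal (annihilator ZQ (conj_module G N)) ZQ"
proof (rule idealI)
  show "ring ZQ" by (rule Q.R.ring_axioms)
  show "subgroup (annihilator ZQ (conj_module G N)) (add_monoid ZQ)"
  proof (rule Q.R.add.subgroupI)
    show "annihilator ZQ (conj_module G N) \<noteq> {}"
      using M.smult_l_null Q.R.zero_closed unfolding annihilator_def by blast
  next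
    fix a assume "a \<in> annihilator ZQ (conj_module G N)"
    then show "\<ominus>\<^bsub>ZQ\<^esub> a \<in> annihilator ZQ (conj_module G N)"
      using M.smult_l_minus by (auto simp: annihilator_def)
  qed (auto simp: annihilator_def M.smult_l_distr)
qed (use smul_assoc smul_closed smul_one Q.R.m_comm in
    \<open>auto simp: annihilator_def conj_module_simps(1,2)\<close>)

section \<open>Points of the action and their stabilizers\<close>

lemma action_mult: "x \<in> E \<Longrightarrow> g \<in> carrier G \<Longrightarrow> h \<in> carrier G \<Longrightarrow> \<phi> (g \<otimes> h) x = \<phi> g (\<phi> h x)"
  by (rule composition_rule)

lemma action_one: "x \<in> E \<Longrightarrow> \<phi> \<one> x = x"
  using id_eq_one by (metis restrict_apply')

lemma action_closed: "x \<in> E \<Longrightarrow> g \<in> carrier G \<Longrightarrow> \<phi> g x \<in> E"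
  using element_image by blast

lemma action_inv: "x \<in> E \<Longrightarrow> g \<in> carrier G \<Longrightarrow> \<phi> (inv g) (\<phi> g x) = x"
  using action_mult[of x "inv g" g] action_one by simp

lemma action_eq_iff:
  assumes "x \<in> E" "g \<in> carrier G" "h \<in> carrier G"
  shows "\<phi> g x = \<phi> h x \<longleftrightarrow> inv h \<otimes> g \<in> stabilizer G \<phi> x"
proof
  assume "\<phi> g x = \<phi> h x"
  then show "inv h \<otimes> g \<in> stabilizer G \<phi> x"
    using assms action_mult action_inv by (simp add: stabilizer_def)
next
  assume "inv h \<otimes> g \<in> stabilizer G \<phi> x"
  then have "\<phi> h (\<phi> (inv h \<otimes> g) x) = \<phi> h x" by (simp add: stabilizer_def)
  then show "\<phi> g x = \<phi> h x"
    using assms action_mult[of x h "inv h \<otimes> g"] by (simp flip: m_assoc)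
qed

lemma ex_moved_point:
  assumes "g \<in> carrier G" "g \<noteq> \<one>"
  shows "\<exists>x\<in>E. \<phi> g x \<noteq> x"
proof (rule ccontr)
  assume "\<not> ?thesis"
  \<comment> \<open>Elements of \<open>Bij\<close> are extensional, so fixing every point of
    \<open>E\<close> means equality with \<open>\<phi> \<one>\<close>.\<close>
  moreover have "\<phi> g \<in> extensional E" using bij_prop0[OF assms(1)] by (simp add: Bij_def)
  ultimately have "\<phi> g = \<phi> \<one>"
    unfolding id_eq_one[symmetric] by (intro extensionalityI[of _ E]) auto
  then show False using faithful assms by (meson inj_onD one_closed)
qed

definition stab_N :: "'c \<Rightarrow> 'a set" where
  "stab_N x = N \<inter> stabilizer G \<phi> x"

lemma stab_N_subgroup: "x \<in> E \<Longrightarrow> subgroup (stab_N x) G"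
  unfolding stab_N_def by (intro subgroups_Inter_pair N.is_subgroup stabilizer_subgroup)

lemma conj_in_stab_N:
  assumes "x \<in> E" "h \<in> carrier G" "v \<in> N"
  shows "h \<otimes> v \<otimes> inv h \<in> stab_N x \<longleftrightarrow> v \<in> stab_N (\<phi> (inv h) x)"
proof -
  have vc: "v \<in> carrier G" using assms(3) by (rule N.mem_carrier)
  have "\<phi> (h \<otimes> v \<otimes> inv h) x = \<phi> h (\<phi> v (\<phi> (inv h) x))"
    using assms vc action_mult action_closed by simp
  moreover have "x = \<phi> h (\<phi> (inv h) x)" using action_inv[OF assms(1), of "inv h"] assms by simp
  moreover have "y = z" if "\<phi> h y = \<phi> h z" "y \<in> E" "z \<in> E" for y z
    using that action_inv assms(2) by metis
  ultimately have "\<phi> (h \<otimes> v \<otimes> inv h) x = x \<longleftrightarrow> \<phi> v (\<phi> (inv h) x) = \<phi> (inv h) x"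
    using action_closed[OF assms(1), of "inv h"] action_closed vc assms(2) by (metis inv_closed)
  then show ?thesis
    using assms vc N.inv_op_closed2 by (simp add: stab_N_def stabilizer_def)
qed

text \<open>The preimage in \<open>G\<close> of the image of the stabilizer in the quotient by
  \<open>N\<close>, so that its cosets are sets of elements of \<open>G\<close>. For
  \<open>x\<close> in \<open>E\<close> it contains \<open>N\<close> and hence all
  commutators.\<close>

definition N_stab :: "'c \<Rightarrow> 'a set" where
  "N_stab x = N <#> stabilizer G \<phi> x"

lemma N_stab_subgroup: "x \<in> E \<Longrightarrow> subgroup (N_stab x) G"
  unfolding N_stab_def by (intro mult_norm_subgroup N.normal_axioms stabilizer_subgroup)

lemma N_stabE:
  assumes "g \<in> N_stab x"
  obtains n s where "n \<in> N" "s \<in> carrier G" "\<phi> s x = x" "g = n \<otimes> s"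
  using assms unfolding N_stab_def set_mult_def stabilizer_def by blast

lemma N_subset_N_stab: "x \<in> E \<Longrightarrow> N \<subseteq> N_stab x"
proof
  fix n assume "x \<in> E" "n \<in> N"
  then have "n = n \<otimes> \<one>" "\<one> \<in> stabilizer G \<phi> x" using N.mem_carrier action_one
    by (auto simp: stabilizer_def)
  with \<open>n \<in> N\<close> show "n \<in> N_stab x" unfolding N_stab_def set_mult_def by blast
qed

lemma stab_subset_N_stab: "stabilizer G \<phi> x \<subseteq> N_stab x"
proof
  fix s assume "s \<in> stabilizer G \<phi> x"
  moreover from this have "s = \<one> \<otimes> s" by (simp add: stabilizer_def)
  ultimately show "s \<in> N_stab x" unfolding N_stab_def set_mult_def using N.one_closed by blast
qed

text \<open>The stabilizer of \<open>\<phi> h x\<close> is a conjugate of that of \<open>x\<close>,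
  and conjugation does not change classes modulo \<open>N\<close> since the quotient is
  abelian.\<close>

lemma N_stab_translate_subset:
  assumes x: "x \<in> E" and h: "h \<in> carrier G"
  shows "N_stab (\<phi> h x) \<subseteq> N_stab x"
proof
  fix g assume "g \<in> N_stab (\<phi> h x)"
  then obtain n s where ns: "n \<in> N" "s \<in> carrier G" "\<phi> s (\<phi> h x) = \<phi> h x" "g = n \<otimes> s"
    by (rule N_stabE)
  define t where "t = inv h \<otimes> s \<otimes> h"
  have tc: "t \<in> carrier G" unfolding t_def using h ns by simp
  have "\<phi> (s \<otimes> h) x = \<phi> h x" using ns x h action_mult by simp
  then have "t \<in> stabilizer G \<phi> x"
    using action_eq_iff[OF x, of "s \<otimes> h" h] ns h by (simp add: t_def m_assoc)
  \<comment> \<open>\<open>s\<close> is the product of this commutator, which lies in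
    \<open>N\<close>, and its conjugate \<open>t\<close>, which fixes \<open>x\<close>.\<close>
  moreover have "s \<otimes> inv h \<otimes> inv s \<otimes> inv (inv h) \<in> N"
    using commutator_in_N[of s "inv h"] ns h by simp
  moreover have "s = s \<otimes> inv h \<otimes> inv s \<otimes> inv (inv h) \<otimes> t"
  proof -
    have "h \<otimes> t = s \<otimes> h" using ns h by (simp add: t_def flip: m_assoc)
    moreover have "inv s \<otimes> (s \<otimes> h) = h" using ns h by (simp flip: m_assoc)
    ultimately have "s \<otimes> inv h \<otimes> inv s \<otimes> h \<otimes> t = s"
      using ns h tc by (simp add: m_assoc)
    then show ?thesis using h by simp
  qed
  ultimately have "s \<in> N_stab x"
    using subgroup.m_closed[OF N_stab_subgroup[OF x]] N_subset_N_stab[OF x] stab_subset_N_stab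
    by (metis subsetD)
  then show "g \<in> N_stab x"
    unfolding ns(4) using subgroup.m_closed[OF N_stab_subgroup[OF x]] N_subset_N_stab[OF x] ns(1)
    by blast
qed

lemma N_stab_translate:
  assumes x: "x \<in> E" and h: "h \<in> carrier G"
  shows "N_stab (\<phi> h x) = N_stab x"
  using N_stab_translate_subset[OF assms]
    N_stab_translate_subset[OF action_closed[OF assms] inv_closed[OF h]] action_inv[OF assms]
  by simp

text \<open>As \<open>N\<close> is abelian, an element of \<open>N_stab x\<close> acts on
  \<open>N\<close> like some element of the stabilizer of \<open>x\<close>, which normalizes
  \<open>stab_N x\<close>.\<close>

lemma N_stab_preserves_stab_N:
  assumes x: "x \<in> E" and a: "a \<in> carrier ZQ"
    and keys: "Poly_Mapping.keys a \<subseteq> (\<lambda>k. N #> k) ` N_stab x"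
    and v: "v \<in> stab_N x"
  shows "a \<bullet> v \<in> stab_N x"
proof (rule smul_in_subgroup[OF stab_N_subgroup[OF x] _ _ a])
  show vN: "v \<in> N" and "stab_N x \<subseteq> N" using v by (auto simp: stab_N_def)
  fix g assume g: "N #> g \<in> Poly_Mapping.keys a" "g \<in> carrier G"
  then obtain k where k: "k \<in> N_stab x" "N #> g = N #> k" using keys by blast
  then obtain n s where ns: "n \<in> N" "s \<in> carrier G" "\<phi> s x = x" "k = n \<otimes> s" by (elim N_stabE)
  have "N #> k = N #> s"
    using ns N.rcos_const[OF group_axioms ns(1)] by (simp add: coset_mult_assoc N.subset N.mem_carrier flip: coset_mult_assoc)
  then have "g \<otimes> v \<otimes> inv g = s \<otimes> v \<otimes> inv s"
    using coset_conj_eq[OF ext _ vN] g(2) k(2) ns(2) by metis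
  moreover have "\<phi> (inv s) x = x" using action_inv[OF x ns(2)] ns(3) by simp
  ultimately show "g \<otimes> v \<otimes> inv g \<in> stab_N x"
    using conj_in_stab_N[OF x ns(2) vN] v by simp
qed

end

section \<open>The lower bound for a single orbit\<close>

context abelian_extension_action
begin

text \<open>The elements killed by \<open>D\<close> form a normal subgroup, as conjugations act
  through scalars, which commute with \<open>D\<close>; if it contained \<open>M\<close>, it would
  contain \<open>N\<close>.\<close>

lemma ex_generator_not_annihilated:
  assumes M: "M \<subseteq> N" "\<And>H. H \<lhd> G \<Longrightarrow> M \<subseteq> H \<Longrightarrow> N \<subseteq> H"
    and D: "D \<in> carrier ZQ" "D \<notin> annihilator ZQ (conj_module G N)"
  shows "\<exists>m\<in>M. D \<bullet> m \<noteq> \<one>"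
proof (rule ccontr)
  assume "\<not> ?thesis"
  then have *: "M \<subseteq> {v \<in> N. D \<bullet> v = \<one>}" using M(1) by blast
  have "{v \<in> N. D \<bullet> v = \<one>} \<lhd> G"
  proof (rule normal_invI)
    show "subgroup {v \<in> N. D \<bullet> v = \<one>} G"
    proof (rule subgroupI)
      show "{v \<in> N. D \<bullet> v = \<one>} \<noteq> {}" using smul_one[OF D(1)] N.one_closed by blast
    next
      fix v assume "v \<in> {v \<in> N. D \<bullet> v = \<one>}"
      then have v: "v \<in> N" "D \<bullet> v = \<one>" "inv v \<in> N" by auto
      have "(D \<bullet> inv v) \<otimes> (D \<bullet> v) = \<one>"
        using smul_mult[OF D(1) v(3,1)] smul_one[OF D(1)] v N.mem_carrier by simp
      then show "inv v \<in> {v \<in> N. D \<bullet> v = \<one>}"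
        using v smul_closed[OF D(1) v(3)] N.mem_carrier by simp
    qed (use smul_mult[OF D(1)] in auto)
  next
    fix g v assume g: "g \<in> carrier G" and "v \<in> {v \<in> N. D \<bullet> v = \<one>}"
    then have v: "v \<in> N" "D \<bullet> v = \<one>" by auto
    have f: "frag_of (N #> g) \<in> carrier ZQ" using coset_carrier[OF g] Q.frag_of_closed by blast
    have eq: "frag_of (N #> g) \<bullet> v = g \<otimes> v \<otimes> inv g"
      using smul_monomial[OF g v(1), of 1] v(1) N.mem_carrier by simp
    have "D \<bullet> (g \<otimes> v \<otimes> inv g) = frag_of (N #> g) \<bullet> D \<bullet> v"
      unfolding eq[symmetric] using smul_assoc[OF D(1) f v(1)] smul_assoc[OF f D(1) v(1)]
        Q.R.m_comm[OF D(1) f] by simp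
    then show "g \<otimes> v \<otimes> inv g \<in> {v \<in> N. D \<bullet> v = \<one>}"
      using v smul_one[OF f] g by (simp add: N.inv_op_closed2)
  qed
  from M(2)[OF this *] show False
    using D by (auto simp: annihilator_def conj_module_simps(1,2))
qed

text \<open>The element \<open>(j q) m\<close>, with \<open>q\<close> the class of
  \<open>g \<otimes> inv g0\<close>, multiplied by a coset representative \<open>r\<close>. Dividing
  by \<open>g0\<close> brings the elements \<open>g\<close> of the coset of \<open>g0\<close> into
  \<open>N_stab x\<close>.\<close>

definition orbit_element :: "'a \<Rightarrow> 'a \<Rightarrow> 'a \<Rightarrow> nat \<Rightarrow> 'a \<Rightarrow> 'a" where
  "orbit_element m g0 r j g = r \<otimes> ((g \<otimes> inv g0) \<otimes> m [^] j \<otimes> inv (g \<otimes> inv g0))"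

text \<open>The product \<open>D\<close> runs over all translated differences, as the point \<open>x\<close> moved by \<open>D \<bullet> m\<close>, and
  with it the class \<open>C\<close> of \<open>F\<close> modulo \<open>N_stab x\<close>, is known only after \<open>D\<close> has been fixed. The factors
  outside \<open>C\<close> are disposed of by moving \<open>x\<close> within its orbit, which leaves \<open>N_stab x\<close> unchanged.\<close>

lemma orbit_lower_bound:
  assumes M: "M \<subseteq> N" "\<And>H. H \<lhd> G \<Longrightarrow> M \<subseteq> H \<Longrightarrow> N \<subseteq> H"
    and p: "primeideal p ZQ" "annihilator ZQ (conj_module G N) \<subseteq> p"
    and F: "finite F" "F \<noteq> {}" "\<And>j g. (j, g) \<in> F \<Longrightarrow> g \<in> carrier G"
    and incong: "\<And>i g j h. (i, g) \<in> F \<Longrightarrow> (j, h) \<in> F \<Longrightarrow> (i, g) \<noteq> (j, h) \<Longrightarrow>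
      frag_cmul (int i) (frag_of (N #> g)) - frag_cmul (int j) (frag_of (N #> h)) \<notin> p"
  shows "\<exists>x\<in>E. \<exists>m\<in>M. \<exists>g0\<in>snd ` F. card F \<le>
    card ((\<lambda>(r, j, g). \<phi> (orbit_element m g0 r j g) x) ` (snd ` F \<times> F))"
proof -
  note I = Q.prime_ideal[OF p(1)]
  \<comment> \<open>The base point \<open>g0\<close> is part of the index, since it is chosen only
    after the product of all differences has been fixed.\<close>
  define d where "d t = (case t of (((i, g), (j, h)), g0) \<Rightarrow>
    frag_cmul (int i) (frag_of (N #> (g \<otimes> inv g0))) - frag_cmul (int j) (frag_of (N #> (h \<otimes> inv g0))))"
    for t :: "((nat \<times> 'a) \<times> (nat \<times> 'a)) \<times> 'a"
  define T where "T C g0s = {t. fst (fst t) \<in> C \<and> snd (fst t) \<in> C \<and> fst (fst t) \<noteq> snd (fst t) \<and> snd t \<in> g0s}"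
    for C :: "(nat \<times> 'a) set" and g0s :: "'a set"
  have T_mono: "T C A \<subseteq> T C' A'" if "C \<subseteq> C'" "A \<subseteq> A'" for C C' A A'
    using that unfolding T_def by blast
  define TF where "TF = T F (snd ` F)"
  have "TF \<subseteq> (F \<times> F) \<times> snd ` F" unfolding TF_def T_def by (simp add: subset_iff mem_Times_iff)
  then have TF_fin: "finite TF" by (rule finite_subset) (use F(1) in simp)
  have d_closed: "d t \<in> carrier ZQ" if t: "t \<in> TF" for t
  proof -
    obtain i g j h g0 where t': "t = (((i, g), (j, h)), g0)" by (metis prod.exhaust)
    have "g \<in> carrier G" "h \<in> carrier G" "g0 \<in> carrier G"
      using t F(3) unfolding t' TF_def T_def by auto
    then show ?thesis unfolding t' d_def
      by (auto intro!: Q.R_diff_closed Q.R_cmul_closed Q.frag_of_closed coset_carrier)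
  qed
  have d_notin: "d t \<in> carrier ZQ - p" if t: "t \<in> TF" for t
  proof -
    obtain i g j h g0 where t': "t = (((i, g), (j, h)), g0)" by (metis prod.exhaust)
    have F': "(i, g) \<in> F" "(j, h) \<in> F" "(i, g) \<noteq> (j, h)" and g0: "g0 \<in> carrier G"
      using t F(3) unfolding t' TF_def T_def by auto
    then have c: "g \<in> carrier G" "h \<in> carrier G" using F(3) by auto
    \<comment> \<open>Multiplication by the class of \<open>g0\<close> undoes the translation, so a
      translated difference in \<open>p\<close> would put the original one into
      \<open>p\<close>.\<close>
    have coset: "(N #> (k \<otimes> inv g0)) \<otimes>\<^bsub>G Mod N\<^esub> (N #> g0) = N #> k" if "k \<in> carrier G" for k
      using that g0 by (simp add: N.rcos_sum m_assoc)
    have q: "frag_of (N #> g0) \<in> carrier ZQ" using g0 by (intro Q.frag_of_closed coset_carrier)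
    have fc: "frag_cmul (int i) (frag_of (N #> (k \<otimes> inv g0))) \<in> carrier ZQ" if "k \<in> carrier G" for i k
      using that g0 by (intro Q.R_cmul_closed Q.frag_of_closed coset_carrier) simp
    have "d t \<otimes>\<^bsub>ZQ\<^esub> frag_of (N #> g0)
        = frag_cmul (int i) (frag_of (N #> g)) - frag_cmul (int j) (frag_of (N #> h))"
      unfolding d_def t' using c fc q
      by (simp add: Q.mult_diff_left Q.mult_cmul_left Q.frag_of_mult coset del: mult_FactGroup)
    then have "d t \<otimes>\<^bsub>ZQ\<^esub> frag_of (N #> g0) \<notin> p" using incong F' by simp
    then show ?thesis using ideal.I_r_closed[OF I _ q, of "d t"] d_closed[OF t] by blast
  qed
  define D where "D = finprod ZQ d TF"
  have "D \<in> carrier ZQ - p"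
    unfolding D_def
  proof (rule Q.R.finprod_in_submonoid)
    fix x y assume "x \<in> carrier ZQ - p" "y \<in> carrier ZQ - p"
    then show "x \<otimes>\<^bsub>ZQ\<^esub> y \<in> carrier ZQ - p" using Q.prime_mult[OF p(1)] by blast
  qed (use Q.prime_one[OF p(1)] d_notin in auto)
  then have D: "D \<in> carrier ZQ" "D \<notin> annihilator ZQ (conj_module G N)" using p(2) by auto
  obtain m where m: "m \<in> M" "D \<bullet> m \<noteq> \<one>" using ex_generator_not_annihilated[OF M D] by blast
  have mN: "m \<in> N" using m(1) M(1) by blast
  obtain x where x: "x \<in> E" "\<phi> (D \<bullet> m) x \<noteq> x"
    using ex_moved_point[OF _ m(2)] smul_closed[OF D(1) mN] N.mem_carrier by blast

  \<comment> \<open>A large class modulo the stabilizer of the moved point\<close>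
  define K where "K = N_stab x"
  have K: "subgroup K G" unfolding K_def by (rule N_stab_subgroup[OF x(1)])
  define cl where "cl f = K #> snd f" for f :: "nat \<times> 'a"
  have "\<exists>y\<in>cl ` F. card F \<le> card (cl -` {y} \<inter> F) * card (cl ` F)"
    by (rule pigeonhole_card) (use F in auto)
  then obtain f0 where f0: "f0 \<in> F" "card F \<le> card (cl -` {cl f0} \<inter> F) * card (cl ` F)" by blast
  define C where "C = cl -` {cl f0} \<inter> F"
  define g0 where "g0 = snd f0"
  have g0: "g0 \<in> carrier G" "g0 \<in> snd ` F" unfolding g0_def using f0 F(3) by (cases f0, auto)+
  have CF: "C \<subseteq> F" unfolding C_def by blast
  have C_in_K: "g \<otimes> inv g0 \<in> K" if "(j, g) \<in> C" for j g
  proof -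
    have gc: "g \<in> carrier G" using that CF F(3) by blast
    have "K #> g = K #> g0" using that unfolding C_def cl_def g0_def by simp
    then have "g \<in> K #> g0" using rcos_self[OF gc K] by simp
    then obtain k where "k \<in> K" "g = k \<otimes> g0" unfolding r_coset_def by blast
    then show ?thesis using g0(1) subgroup.mem_carrier[OF K] by (simp add: m_assoc)
  qed
  define TC where "TC = T C {g0}"
  have TC: "TC \<subseteq> TF" unfolding TC_def TF_def using CF g0 by (intro T_mono) auto
  have TC_fin: "finite TC" using TC TF_fin by (rule finite_subset)
  define DC where "DC = finprod ZQ d TC"
  define D' where "D' = finprod ZQ d (TF - TC)"
  have DC: "DC \<in> carrier ZQ" and D': "D' \<in> carrier ZQ"
    unfolding DC_def D'_def using d_closed TC by (auto intro!: Q.R.finprod_closed)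
  have "D = finprod ZQ d (TC \<union> (TF - TC))" unfolding D_def using TC by (simp add: Un_absorb1)
  also have "\<dots> = DC \<otimes>\<^bsub>ZQ\<^esub> D'"
    unfolding DC_def D'_def using TC TC_fin TF_fin d_closed
    by (intro Q.R.finprod_Un_disjoint) auto
  finally have "D \<bullet> m = D' \<bullet> DC \<bullet> m"
    using smul_assoc[OF D' DC mN] Q.R.m_comm[OF DC D'] by simp
  moreover have "D \<bullet> m \<notin> stab_N x" using x(2) by (simp add: stab_N_def stabilizer_def)
  \<comment> \<open>Applying \<open>D'\<close> only combines conjugates, so some conjugate of
    \<open>DC \<bullet> m\<close> lies outside \<open>stab_N x\<close>. Moving \<open>x\<close> by
    \<open>inv h\<close> turns this into a statement about \<open>DC \<bullet> m\<close>
    itself.\<close>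
  ultimately obtain h where h: "h \<in> carrier G" "h \<otimes> (DC \<bullet> m) \<otimes> inv h \<notin> stab_N x"
    using smul_in_subgroup[OF stab_N_subgroup[OF x(1)], of D' "DC \<bullet> m"] D' smul_closed[OF DC mN]
    unfolding stab_N_def by (metis inf_le1)
  define y where "y = \<phi> (inv h) x"
  have y: "y \<in> E" unfolding y_def using x(1) h(1) action_closed by simp
  have Ky: "N_stab y = K" unfolding y_def K_def using x(1) h(1) by (simp add: N_stab_translate)
  have DCm: "DC \<bullet> m \<notin> stab_N y"
    using conj_in_stab_N[OF x(1) h(1) smul_closed[OF DC mN]] h(2) unfolding y_def by blast
  \<comment> \<open>The factors of \<open>DC\<close> have support in the image of \<open>K\<close>
    and thus preserve \<open>stab_N y\<close>. If one of them carried \<open>m\<close> into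
    \<open>stab_N y\<close>, so would the whole product.\<close>
  have dm: "d t \<bullet> m \<notin> stab_N y" if t: "t \<in> TC" for t
  proof
    assume dt: "d t \<bullet> m \<in> stab_N y"
    define P where "P = {a \<in> carrier ZQ. \<forall>v\<in>stab_N y. a \<bullet> v \<in> stab_N y}"
    have sN: "v \<in> N" if "v \<in> stab_N y" for v using that by (simp add: stab_N_def)
    have "finprod ZQ d (TC - {t}) \<in> P"
    proof (rule Q.R.finprod_in_submonoid)
      show "\<one>\<^bsub>ZQ\<^esub> \<in> P"
        unfolding P_def using M.smult_one sN by (auto simp: conj_module_simps(1))
    next
      fix a b assume "a \<in> P" "b \<in> P"
      then show "a \<otimes>\<^bsub>ZQ\<^esub> b \<in> P" unfolding P_def using smul_assoc sN by simp
    next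
      fix s assume "s \<in> TC - {t}"
      then have s: "s \<in> TC" by blast
      obtain i g j h g' where s': "s = (((i, g), (j, h)), g')" by (metis prod.exhaust)
      have c: "(i, g) \<in> C" "(j, h) \<in> C" "g' = g0" using s unfolding s' TC_def T_def by auto
      have "Poly_Mapping.keys (d s) \<subseteq> {N #> (g \<otimes> inv g0), N #> (h \<otimes> inv g0)}"
        unfolding d_def s' c(3) using keys_diff
        by (auto dest!: subsetD[OF keys_diff] split: if_splits)
      also have "\<dots> \<subseteq> (\<lambda>k. N #> k) ` N_stab y" unfolding Ky using c C_in_K by blast
      finally show "d s \<in> P"
        unfolding P_def using N_stab_preserves_stab_N[OF y] d_closed s TC by blast
    qed (auto simp: P_def)
    then have rest: "finprod ZQ d (TC - {t}) \<in> carrier ZQ"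
      and rest_dt: "finprod ZQ d (TC - {t}) \<bullet> d t \<bullet> m \<in> stab_N y"
      using dt unfolding P_def by blast+
    have dTC: "d \<in> TC - {t} \<rightarrow> carrier ZQ" "d t \<in> carrier ZQ" using d_closed TC t by blast+
    have "DC = d t \<otimes>\<^bsub>ZQ\<^esub> finprod ZQ d (TC - {t})"
      unfolding DC_def using Q.R.finprod_insert[of "TC - {t}" t d] TC_fin dTC
      by (simp add: insert_absorb[OF t])
    then have "DC \<bullet> m = finprod ZQ d (TC - {t}) \<bullet> d t \<bullet> m"
      using smul_assoc[OF rest dTC(2) mN] Q.R.m_comm[OF rest dTC(2)] by simp
    then show False using DCm rest_dt by simp
  qed

  \<comment> \<open>Distinct points of the orbit\<close>
  define u where "u = (\<lambda>(j, g). (g \<otimes> inv g0) \<otimes> m [^] (j::nat) \<otimes> inv (g \<otimes> inv g0))"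
  have mc: "m [^] j \<in> N" for j :: nat
    using subgroup_int_pow_closed[OF N.is_subgroup mN, of "int j"] by (simp add: int_pow_int)
  have u: "u f \<in> N" if "f \<in> C" for f
    using that CF F(3) g0 mc N.inv_op_closed2 unfolding u_def by (cases f) auto
  have u_eq: "f = f'" if f: "f \<in> C" "f' \<in> C" and eq: "\<phi> (u f) y = \<phi> (u f') y" for f f'
  proof (rule ccontr)
    assume ne: "f \<noteq> f'"
    then have t: "((f, f'), g0) \<in> TC" unfolding TC_def T_def using f by simp
    obtain i g j h where ff: "f = (i, g)" "f' = (j, h)" by fastforce
    have c: "g \<in> carrier G" "h \<in> carrier G" using f CF F(3) unfolding ff by auto
    \<comment> \<open>If the two points agree, the difference of the two scalars carries
      \<open>m\<close> into \<open>stab_N y\<close>, contrary to \<open>dm\<close>.\<close>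
    have "d ((f, f'), g0) \<bullet> m = u f \<otimes> inv (u f')"
      unfolding d_def ff u_def using c g0 mN
      by (simp add: smul_diff smul_monomial Q.R_cmul_closed Q.frag_of_closed coset_carrier)
    also have "\<dots> = inv (u f') \<otimes> u f"
      using NG.m_comm u[OF f(1)] u[OF f(2)] by simp
    also have "\<dots> \<in> stab_N y"
      using action_eq_iff[OF y] eq u[OF f(1)] u[OF f(2)] N.mem_carrier by (simp add: stab_N_def)
    finally show False using dm[OF t] by blast
  qed
  \<comment> \<open>Coset representatives are taken from \<open>F\<close> itself, so that bounds on
    the word lengths in \<open>F\<close> apply to them.\<close>
  define \<rho> where "\<rho> c = snd (SOME f. f \<in> F \<and> cl f = c)" for c
  have \<rho>: "\<rho> c \<in> snd ` F" "\<rho> c \<in> carrier G" "K #> \<rho> c = c" if "c \<in> cl ` F" for c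
  proof -
    have "\<exists>f. f \<in> F \<and> cl f = c" using that by blast
    from someI_ex[OF this] have "(SOME f. f \<in> F \<and> cl f = c) \<in> F" "cl (SOME f. f \<in> F \<and> cl f = c) = c"
      by auto
    then show "\<rho> c \<in> snd ` F" "\<rho> c \<in> carrier G" "K #> \<rho> c = c"
      unfolding \<rho>_def cl_def using F(3) by (auto, metis prod.collapse)
  qed
  have inj_aux: "c = c' \<and> f = f'"
    if c: "c \<in> cl ` F" "c' \<in> cl ` F" and f: "f \<in> C" "f' \<in> C"
      and eq: "\<phi> (\<rho> c \<otimes> u f) y = \<phi> (\<rho> c' \<otimes> u f') y" for c c' f f'
  proof -
    define a b where "a = \<rho> c" and "b = \<rho> c'"
    have ab: "a \<in> carrier G" "b \<in> carrier G" unfolding a_def b_def using \<rho>(2) c by auto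
    have uN: "u f \<in> N" "u f' \<in> N" using u f by auto
    then have uc: "u f \<in> carrier G" "u f' \<in> carrier G" using N.mem_carrier by auto
    have NK: "N \<subseteq> K" unfolding K_def by (rule N_subset_N_stab[OF x(1)])
    define s where "s = inv (b \<otimes> u f') \<otimes> (a \<otimes> u f)"
    have sK: "s \<in> K"
      using action_eq_iff[OF y, of "a \<otimes> u f" "b \<otimes> u f'"] eq ab uc
        stab_subset_N_stab[of y] unfolding Ky s_def a_def b_def by auto
    have "u f' \<otimes> s \<otimes> inv (u f) = inv b \<otimes> a"
      unfolding s_def using ab uc by (simp add: inv_mult_group m_assoc flip: m_assoc[of "u f'" "inv (u f')"])
    moreover have "u f' \<otimes> s \<otimes> inv (u f) \<in> K"
      using K sK NK uN by (meson subgroup.m_closed subgroup.m_inv_closed subsetD)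
    ultimately have "inv b \<otimes> a \<in> K" by simp
    \<comment> \<open>This passes from \<open>inv b \<otimes> a\<close> to
      \<open>a \<otimes> inv b\<close>: left and right cosets of \<open>K\<close> agree because
      \<open>K\<close> contains all commutators.\<close>
    moreover have "a \<otimes> inv b \<otimes> inv a \<otimes> inv (inv b) \<in> K" using commutator_in_N ab NK by blast
    ultimately have "a \<otimes> inv b \<otimes> inv a \<otimes> inv (inv b) \<otimes> (inv b \<otimes> a) \<in> K"
      using subgroup.m_closed[OF K] by blast
    moreover have "a \<otimes> inv b \<otimes> inv a \<otimes> inv (inv b) \<otimes> (inv b \<otimes> a) = a \<otimes> inv b"
      using ab by (simp add: m_assoc flip: m_assoc[of b "inv b"])
    ultimately have "a \<otimes> inv b \<in> K" by simp
    then have "K #> a = K #> b" using ab K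
      by (metis coset_join2 coset_mult_inv1 coset_mult_inv2 inv_closed m_closed subgroup.subset)
    then have "c = c'" using \<rho>(3) c by (simp add: a_def b_def)
    moreover from this have "\<phi> (u f) y = \<phi> (u f') y"
      using eq action_mult[OF y] ab uc action_inv action_closed[OF y] unfolding a_def b_def by metis
    then have "f = f'" using u_eq f by blast
    ultimately show "c = c' \<and> f = f'" by simp
  qed
  have inj: "inj_on (\<lambda>(c, f). \<phi> (\<rho> c \<otimes> u f) y) (cl ` F \<times> C)"
  proof (rule inj_onI)
    fix s t assume "s \<in> cl ` F \<times> C" "t \<in> cl ` F \<times> C"
      "(case s of (c, f) \<Rightarrow> \<phi> (\<rho> c \<otimes> u f) y) = (case t of (c, f) \<Rightarrow> \<phi> (\<rho> c \<otimes> u f) y)"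
    then show "s = t"
      using inj_aux[of "fst s" "fst t" "snd s" "snd t"]
      by (simp add: case_prod_beta mem_Times_iff prod_eq_iff)
  qed
  have "card F \<le> card (cl ` F \<times> C)"
    using f0(2) unfolding C_def by (simp add: card_cartesian_product mult.commute)
  also have "\<dots> = card ((\<lambda>(c, f). \<phi> (\<rho> c \<otimes> u f) y) ` (cl ` F \<times> C))"
    using card_image[OF inj] by simp
  \<comment> \<open>Enlarging the index set to all of \<open>F\<close> removes the class
    \<open>C\<close> and the choice \<open>\<rho>\<close> from the bound.\<close>
  also have "\<dots> \<le> card ((\<lambda>(r, j, g). \<phi> (orbit_element m g0 r j g) y) ` (snd ` F \<times> F))"
  proof (rule card_mono)
    show "(\<lambda>(c, f). \<phi> (\<rho> c \<otimes> u f) y) ` (cl ` F \<times> C)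
        \<subseteq> (\<lambda>(r, j, g). \<phi> (orbit_element m g0 r j g) y) ` (snd ` F \<times> F)"
    proof
      fix z assume "z \<in> (\<lambda>(c, f). \<phi> (\<rho> c \<otimes> u f) y) ` (cl ` F \<times> C)"
      then obtain c j g where z: "c \<in> cl ` F" "(j, g) \<in> C" "z = \<phi> (\<rho> c \<otimes> u (j, g)) y" by auto
      then have "(\<rho> c, j, g) \<in> snd ` F \<times> F" using \<rho>(1) CF by blast
      moreover have "z = (\<lambda>(r, j, g). \<phi> (orbit_element m g0 r j g) y) (\<rho> c, j, g)"
        using z(3) by (simp add: orbit_element_def u_def)
      ultimately show "z \<in> (\<lambda>(r, j, g). \<phi> (orbit_element m g0 r j g) y) ` (snd ` F \<times> F)" by blast
    qed
  qed (use F(1) in simp)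
  finally show ?thesis using y m(1) g0(2) by blast
qed

end

section \<open>The growth gap\<close>

text \<open>A finite positive supremum of natural numbers is attained, since otherwise
  \<open>k - 1\<close> would be an upper bound. Dimension \<open>0\<close> is also the value at the
  zero ring, which has no primes at all.\<close>

lemma krull_dim_chain:
  assumes "krull_dim A = enat k" "k > 0"
  shows "\<exists>p. (\<forall>i\<le>k. primeideal (p i) A) \<and> (\<forall>i<k. p i \<subset> p (Suc i))"
proof (rule ccontr)
  assume no: "\<not> ?thesis"
  define L where "L = {enat n | n. \<exists>p :: nat \<Rightarrow> 'a set.
       (\<forall>i\<le>n. primeideal (p i) A) \<and> (\<forall>i<n. p i \<subset> p (Suc i))}"
  have Sup: "Sup L = enat k" using assms(1) by (simp add: krull_dim_def L_def)
  have "l \<le> enat (k - 1)" if "l \<in> L" for l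
  proof -
    obtain n where n: "l = enat n" "\<exists>p :: nat \<Rightarrow> 'a set.
       (\<forall>i\<le>n. primeideal (p i) A) \<and> (\<forall>i<n. p i \<subset> p (Suc i))"
      using \<open>l \<in> L\<close> unfolding L_def by blast
    have "n \<noteq> k" using n(2) no by blast
    moreover have "enat n \<le> enat k" using Sup_upper[OF that] Sup n(1) by simp
    ultimately show ?thesis using n(1) by simp
  qed
  then have "Sup L \<le> enat (k - 1)" by (rule Sup_least)
  then show False using Sup assms(2) by simp
qed

text \<open>Primes of the quotient are pulled back along the projection, whose surjectivity keeps
  the inclusions strict.\<close>

lemma (in cring) krull_dim_quotient_chain:
  assumes I: "ideal I R" and k: "krull_dim (R Quot I) = enat k" "k > 0"
  shows "\<exists>p. (\<forall>i\<le>k. primeideal (p i) R) \<and> (\<forall>i<k. p i \<subset> p (Suc i)) \<and> I \<subseteq> p 0"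
proof -
  interpret I: ideal I R by fact
  interpret h: ring_hom_ring R "R Quot I" "(+>) I" by (rule I.rcos_ring_hom_ring)
  obtain q where q: "\<And>i. i \<le> k \<Longrightarrow> primeideal (q i) (R Quot I)" "\<And>i. i < k \<Longrightarrow> q i \<subset> q (Suc i)"
    using krull_dim_chain[OF k] by blast
  define p where "p i = {r \<in> carrier R. I +> r \<in> q i}" for i
  have "primeideal (p i) R" if "i \<le> k" for i
    unfolding p_def by (rule h.primeideal_vimage[OF is_cring q(1)[OF that]])
  moreover have "p i \<subset> p (Suc i)" if i: "i < k" for i
  proof
    show "p i \<subseteq> p (Suc i)" unfolding p_def using q(2)[OF i] by blast
    obtain c where c: "c \<in> q (Suc i)" "c \<notin> q i" using q(2)[OF i] by blast
    have "ideal (q (Suc i)) (R Quot I)" using q(1)[of "Suc i"] i by (simp add: primeideal.axioms)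
    then have "c \<in> carrier (R Quot I)" using c(1) ideal.Icarr by metis
    then obtain r where "r \<in> carrier R" "c = I +> r"
      unfolding FactRing_def A_RCOSETS_def' partial_object.simps by blast
    with c show "p i \<noteq> p (Suc i)" unfolding p_def by blast
  qed
  moreover have "I \<subseteq> p 0"
  proof
    fix a assume a: "a \<in> I"
    have "I +> a = I" by (rule I.a_rcos_const[OF a])
    moreover have "\<zero>\<^bsub>R Quot I\<^esub> = I" unfolding FactRing_def by simp
    moreover have "\<zero>\<^bsub>R Quot I\<^esub> \<in> q 0"
      by (intro additive_subgroup.zero_closed ideal.axioms(1) primeideal.axioms(1) q(1)) simp
    ultimately show "a \<in> p 0" unfolding p_def using I.Icarr[OF a] by simp
  qed
  ultimately show ?thesis by blast
qed

theorem theorem2: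
  fixes G :: "('a, 'b) monoid_scheme" and k :: nat
  assumes "group G"
    and "finitely_generated G"
    and "metabelian G"
    and "\<not> virtually_abelian G"
    and "has_krull_dim G (enat k)"
  shows "schreier_growth_gap TYPE('x) G (\<lambda>n. real n ^ k)"
  unfolding schreier_growth_gap_def
proof (intro allI impI)
  fix S :: "'a set" and E :: "'x set" and \<phi>
  assume S: "finite S" "symmetric_generating_set G S" and E: "E \<noteq> {}" and act: "faithful_action G E \<phi>"
  obtain N where N: "abelian_extension G N"
    and dim: "module_krull_dim (int_group_ring (G Mod N)) (conj_module G N) = enat k"
    using assms(5) unfolding has_krull_dim_def by metis
  interpret A: abelian_extension_action G E \<phi> N
    using act N by (intro abelian_extension_action.intro abelian_extension_action_axioms.intro)
  interpret W: group_generators G S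
    using S(2) by (intro group_generators.intro group_generators_axioms.intro) (rule A.group_axioms)
  let ?R = "int_group_ring (G Mod N)"
  show "(\<lambda>n. real n ^ k) \<preceq>\<^sub>g (\<lambda>n. real (action_growth G S E \<phi> n))"
  proof (cases "k = 0")
    case True
    obtain x where x: "x \<in> E" using E by blast
    \<comment> \<open>Without a chain of primes at hand, it is enough here that balls contain the
      identity.\<close>
    have "1 \<le> action_growth G S E \<phi> n" for n
    proof -
      have "\<one>\<^bsub>G\<^esub> \<in> W.ball n" by (simp add: W.ball_def W.word_length_one)
      then have "0 < card ((\<lambda>g. \<phi> g x) ` W.ball n)"
        using W.finite_ball[OF S(1)] by (auto simp: card_gt_0_iff)
      then show ?thesis using W.card_orbit_le_action_growth[OF S(1) x, of \<phi> n] by linarith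
    qed
    then show ?thesis
      unfolding growth_le_def True by (intro exI[of _ 1]) (auto intro!: always_eventually)
  next
    case False
    have k: "0 < k" using False by simp
    obtain p where "\<forall>i\<le>k. primeideal (p i) ?R" "\<forall>i<k. p i \<subset> p (Suc i)"
      and ann: "annihilator ?R (conj_module G N) \<subseteq> p 0"
      using A.Q.R.krull_dim_quotient_chain[OF A.annihilator_ideal dim[unfolded module_krull_dim_def] k]
      by blast
    then have p: "\<And>i. i \<le> k \<Longrightarrow> primeideal (p i) ?R" "\<And>i. i < k \<Longrightarrow> p i \<subset> p (Suc i)" by simp_all
    have gen: "generate G S = carrier G" using S(2) by (simp add: symmetric_generating_set_def)
    obtain M where M: "finite M" "M \<subseteq> N" "\<forall>H. H \<lhd> G \<longrightarrow> M \<subseteq> H \<longrightarrow> N \<subseteq> H"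
      using A.abelian_extension_normally_finitely_generated[OF S(1) W.S_subset gen
          A.N.normal_axioms A.Q.comm_group_axioms]
      by blast
    define B where "B n = (\<lambda>g. N #>\<^bsub>G\<^esub> g) ` W.ball n" for n
    have "filtered_group_ring (G Mod N) B"
    proof (unfold_locales)
      show "(\<Union>n. B n) = carrier (G Mod N)"
        by (auto simp: B_def W.ball_def carrier_FactGroup)
      show "m \<le> n \<Longrightarrow> B m \<subseteq> B n" for m n
        by (auto simp: B_def W.ball_def)
      have "\<one>\<^bsub>G Mod N\<^esub> = N #>\<^bsub>G\<^esub> \<one>\<^bsub>G\<^esub>"
        using A.coset_mult_one A.N.subset by (simp add: FactGroup_def)
      then show "\<one>\<^bsub>G Mod N\<^esub> \<in> B 0"
        by (auto simp: B_def W.ball_def W.word_length_one)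
      show "finite (B n)" for n
        unfolding B_def using W.finite_ball[OF S(1)] by blast
      fix x y m n assume "x \<in> B m" "y \<in> B n"
      then obtain g h where gh: "g \<in> W.ball m" "x = N #>\<^bsub>G\<^esub> g" "h \<in> W.ball n" "y = N #>\<^bsub>G\<^esub> h"
        by (auto simp: B_def)
      then have "x \<otimes>\<^bsub>G Mod N\<^esub> y = N #>\<^bsub>G\<^esub> (g \<otimes>\<^bsub>G\<^esub> h)"
        by (simp add: A.N.rcos_sum W.ball_def)
      moreover have "g \<otimes>\<^bsub>G\<^esub> h \<in> W.ball (m + n)"
        using gh W.word_length_mult[of g h] by (simp add: W.ball_def)
      ultimately show "x \<otimes>\<^bsub>G Mod N\<^esub> y \<in> B (m + n)" unfolding B_def by blast
    qed
    then interpret B: filtered_group_ring "G Mod N" B .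
    obtain D where D: "\<And>n. n > 0 \<Longrightarrow> \<exists>F. F \<subseteq> {1..n} \<times> B (D * n) \<and> n ^ k \<le> card F \<and>
           (\<forall>(i, s)\<in>F. \<forall>(j, t)\<in>F. (i, s) \<noteq> (j, t) \<longrightarrow>
              frag_cmul (int i) (frag_of s) - frag_cmul (int j) (frag_of t) \<notin> p 0)"
      using B.prime_chain_incongruent[where k = k and p = p, OF p] by blast
    \<comment> \<open>Inserting \<open>0\<close> keeps \<open>Max\<close> meaningful for empty
      \<open>M\<close>.\<close>
    define L where "L = Max (insert 0 (word_length G S ` M))"
    have L: "word_length G S m \<le> L" if "m \<in> M" for m
      unfolding L_def using M(1) that by (intro Max_ge) auto
    \<comment> \<open>\<open>D\<close> pays for the representative \<open>r\<close>,
      \<open>2 * D\<close> for \<open>g \<otimes> inv g0\<close> and again for its inverse, and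
      \<open>L\<close> for the power of \<open>m\<close>; the \<open>1\<close> makes
      \<open>C\<close> positive.\<close>
    define C where "C = 5 * D + L + 1"
    have "n ^ k \<le> action_growth G S E \<phi> (C * n)" if n: "n > 0" for n
    proof -
      obtain F0 where F0: "F0 \<subseteq> {1..n} \<times> B (D * n)" "n ^ k \<le> card F0"
        "\<forall>(i, s)\<in>F0. \<forall>(j, t)\<in>F0. (i, s) \<noteq> (j, t) \<longrightarrow>
              frag_cmul (int i) (frag_of s) - frag_cmul (int j) (frag_of t) \<notin> p 0"
        using D[OF n] by blast
      have "\<forall>s\<in>B (D * n). \<exists>g. g \<in> W.ball (D * n) \<and> N #>\<^bsub>G\<^esub> g = s"
        unfolding B_def by blast
      \<comment> \<open>\<open>\<sigma>\<close> lifts classes to elements of the ball of the same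
        radius in \<open>G\<close>, so that incongruence in the quotient and word length in
        \<open>G\<close> are available together.\<close>
      from bchoice[OF this] obtain \<sigma>
        where \<sigma>: "\<forall>s\<in>B (D * n). \<sigma> s \<in> W.ball (D * n) \<and> N #>\<^bsub>G\<^esub> \<sigma> s = s" by blast
      have F0B: "j \<le> n \<and> \<sigma> s \<in> W.ball (D * n) \<and> N #>\<^bsub>G\<^esub> \<sigma> s = s" if "(j, s) \<in> F0" for j s
        using that F0(1) \<sigma> by auto
      define F where "F = (\<lambda>(j, s). (j, \<sigma> s)) ` F0"
      have inj: "inj_on (\<lambda>(j, s). (j, \<sigma> s)) F0"
      proof (rule inj_onI)
        fix a b assume ab: "a \<in> F0" "b \<in> F0"
          and eq: "(case a of (j, s) \<Rightarrow> (j, \<sigma> s)) = (case b of (j, s) \<Rightarrow> (j, \<sigma> s))"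
        have \<sigma>ab: "N #>\<^bsub>G\<^esub> \<sigma> (snd a) = snd a" "N #>\<^bsub>G\<^esub> \<sigma> (snd b) = snd b"
          using F0B[of "fst a" "snd a"] F0B[of "fst b" "snd b"] ab by auto
        have "fst a = fst b" "\<sigma> (snd a) = \<sigma> (snd b)" using eq by (simp_all add: case_prod_beta)
        moreover from this have "snd a = snd b" using \<sigma>ab by argo
        ultimately show "a = b" by (simp add: prod_eq_iff)
      qed
      have F: "j \<le> n \<and> g \<in> W.ball (D * n) \<and> (j, N #>\<^bsub>G\<^esub> g) \<in> F0" if "(j, g) \<in> F" for j g
      proof -
        obtain s where s: "(j, s) \<in> F0" "g = \<sigma> s" using \<open>(j, g) \<in> F\<close> unfolding F_def by auto
        then show ?thesis using F0B[OF s(1)] by simp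
      qed
      have Fc: "g \<in> carrier G" if "(j, g) \<in> F" for j g
        using F[OF that] by (simp add: W.ball_def)
      have "finite F0" by (rule finite_subset[OF F0(1)]) (simp add: B.B_finite)
      then have finF: "finite F" unfolding F_def by simp
      have cardF: "n ^ k \<le> card F" unfolding F_def using F0(2) card_image[OF inj] by simp
      have F_ne: "F \<noteq> {}" using cardF n by auto
      have incong: "frag_cmul (int i) (frag_of (N #>\<^bsub>G\<^esub> g)) - frag_cmul (int j) (frag_of (N #>\<^bsub>G\<^esub> h)) \<notin> p 0"
        if f: "(i, g) \<in> F" "(j, h) \<in> F" "(i, g) \<noteq> (j, h)" for i g j h
      proof -
        have "(i, N #>\<^bsub>G\<^esub> g) \<noteq> (j, N #>\<^bsub>G\<^esub> h)"
        proof
          assume *: "(i, N #>\<^bsub>G\<^esub> g) = (j, N #>\<^bsub>G\<^esub> h)"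
          obtain s where s: "(i, s) \<in> F0" "g = \<sigma> s" using f(1) unfolding F_def by auto
          obtain t where t: "(j, t) \<in> F0" "h = \<sigma> t" using f(2) unfolding F_def by auto
          have "s = t" using * F0B[OF s(1)] F0B[OF t(1)] s(2) t(2) by simp
          with * f(3) s(2) t(2) show False by simp
        qed
        then show ?thesis using F0(3) F[OF f(1)] F[OF f(2)] by fast
      qed
      have "\<exists>x\<in>E. \<exists>m\<in>M. \<exists>g0\<in>snd ` F. card F \<le>
          card ((\<lambda>(r, j, g). \<phi> (A.orbit_element m g0 r j g) x) ` (snd ` F \<times> F))"
      proof (rule A.orbit_lower_bound[OF M(2) _ p(1)[OF le0] ann finF F_ne])
        show "N \<subseteq> H" if "H \<lhd> G" "M \<subseteq> H" for H using M(3) that by blast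
      qed (fact Fc incong)+
      then obtain x m g0 where x: "x \<in> E" "m \<in> M" "g0 \<in> snd ` F"
        and card: "card F \<le> card ((\<lambda>(r, j, g). \<phi> (A.orbit_element m g0 r j g) x) ` (snd ` F \<times> F))"
        by blast
      have in_ball: "A.orbit_element m g0 r j g \<in> W.ball (C * n)" if r: "r \<in> snd ` F" and jg: "(j, g) \<in> F" for r j g
      proof -
        have *: "h \<in> carrier G \<and> word_length G S h \<le> D * n" if "h \<in> snd ` F" for h
          using that F unfolding W.ball_def by auto
        have c: "r \<in> carrier G" "g \<in> carrier G" "g0 \<in> carrier G" "m \<in> carrier G"
          using * r x(3) F[OF jg] x(2) M(2) A.N.mem_carrier unfolding W.ball_def by auto
        have len: "word_length G S r \<le> D * n" "word_length G S g \<le> D * n" "word_length G S g0 \<le> D * n"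
          using * r x(3) F[OF jg] unfolding W.ball_def by auto
        define w where "w = g \<otimes>\<^bsub>G\<^esub> inv\<^bsub>G\<^esub> g0"
        have w: "w \<in> carrier G" unfolding w_def using c by simp
        have wl: "word_length G S w \<le> 2 * (D * n)"
          using W.word_length_mult[of g "inv\<^bsub>G\<^esub> g0"] W.word_length_inv[of g0] len c unfolding w_def by simp
        have "word_length G S (m [^]\<^bsub>G\<^esub> j) \<le> j * L"
          using W.word_length_pow[OF c(4), of j] L[OF x(2)] mult_le_mono2 order_trans by blast
        also have "\<dots> \<le> L * n" using F[OF jg] by simp
        finally have ml: "word_length G S (m [^]\<^bsub>G\<^esub> j) \<le> L * n" .
        have "word_length G S (r \<otimes>\<^bsub>G\<^esub> (w \<otimes>\<^bsub>G\<^esub> m [^]\<^bsub>G\<^esub> j \<otimes>\<^bsub>G\<^esub> inv\<^bsub>G\<^esub> w))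
            \<le> D * n + (2 * (D * n) + L * n + 2 * (D * n))"
          using W.word_length_mult[of r "w \<otimes>\<^bsub>G\<^esub> m [^]\<^bsub>G\<^esub> j \<otimes>\<^bsub>G\<^esub> inv\<^bsub>G\<^esub> w"]
            W.word_length_mult[of "w \<otimes>\<^bsub>G\<^esub> m [^]\<^bsub>G\<^esub> j" "inv\<^bsub>G\<^esub> w"]
            W.word_length_mult[of w "m [^]\<^bsub>G\<^esub> j"] W.word_length_inv[OF w] len wl ml c w by simp
        also have "\<dots> \<le> C * n" by (simp add: C_def algebra_simps)
        finally show ?thesis
          using c w by (simp add: A.orbit_element_def W.ball_def w_def)
      qed
      have "(\<lambda>(r, j, g). \<phi> (A.orbit_element m g0 r j g) x) ` (snd ` F \<times> F)
          \<subseteq> (\<lambda>g. \<phi> g x) ` W.ball (C * n)"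
      proof (rule image_subsetI)
        fix t assume t: "t \<in> snd ` F \<times> F"
        obtain r j g where "t = (r, j, g)" by (rule prod_cases3)
        with t show "(case t of (r, j, g) \<Rightarrow> \<phi> (A.orbit_element m g0 r j g) x)
            \<in> (\<lambda>g. \<phi> g x) ` W.ball (C * n)"
          by (simp add: in_ball)
      qed
      then have "card F \<le> card ((\<lambda>g. \<phi> g x) ` W.ball (C * n))"
        using card card_mono[OF finite_imageI[OF W.finite_ball[OF S(1)]]] order_trans by blast
      also have "\<dots> \<le> action_growth G S E \<phi> (C * n)"
        by (rule W.card_orbit_le_action_growth[OF S(1) x(1)])
      finally show ?thesis using cardF by linarith
    qed
    then have "real n ^ k \<le> real C * real (action_growth G S E \<phi> (C * n))" if "n > 0" for n
    proof -
      have "n ^ k \<le> C * action_growth G S E \<phi> (C * n)"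
        using \<open>n > 0 \<Longrightarrow> n ^ k \<le> action_growth G S E \<phi> (C * n)\<close> that by (simp add: C_def)
      then have "real (n ^ k) \<le> real (C * action_growth G S E \<phi> (C * n))" by (rule of_nat_mono)
      then show ?thesis by simp
    qed
    moreover have "C > 0" by (simp add: C_def)
    ultimately show ?thesis
      unfolding growth_le_def
      by (intro exI[of _ C]) (auto intro: eventually_mono[OF eventually_gt_at_top[of 0]])
  qed
qed

end
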